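(* Suppose two normal PEPS, with tensors $(A_s)_s$ and $(B_s)_s$, generating the same state satisfy the following: (1) they can be blocked into tripartite injective MPS around every edge; (2) for every site, there are injective regions that differ only in the given site, and also their complements are injective. Then the defining tensors are related by a local gauge transformation, i.e. there are invertible matrices $Z_i$, which cancel out with those of the neighbouring tensor when the contraction is carried out, such that $$A_s=B_s\Big(\bigotimes_i Z_i\Big).$$ Moreover, the matrices of the gauge transformation are unique up to a multiplicative constant.
   Context: A PEPS on a lattice or graph assigns to each edge a finite-dimensional bond space and to each site (vertex) $s$ a tensor $A_s$ with one physical index (in a finite-dimensional space) and one virtual index for each edge incident to $s$. The generated state is obtained by contracting, for each edge, the two virtual indices at its ends. The two PEPS are defined on the same graph with the same physical spaces; the system size is fixed and translation invariance is not assumed. In the formula, $i$ runs over the virtual indices of site $s$, and $B_s(\bigotimes_i Z_i)$ means that the matrices $Z_i$ are applied to the virtual indices of $B_s$; at the two ends of each edge the applied matrices are inverse to each other. For a region $R$ (a set of sites) the blocked tensor is obtained by contracting all edges inside $R$; it defines a linear map from the tensor product of the virtual spaces of the edges leaving $R$ to the tensor product of the physical spaces of the sites of $R$. The region $R$ is injective if this map is injective. A PEPS is normal if after blocking regions the resulting blocked tensors are injective. Blocking a PEPS into a tripartite injective MPS around an edge means grouping its sites into three injective regions, so that the PEPS becomes a three-site matrix product state (three tensors on a ring), with the given edge as the bond between two of the three blocks.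
   Formalization: The graph is assumed connected; for two isolated sites with A_1 = 2B_1, A_2 = B_2/2 the states agree and (1), (2) hold, but no gauge transformation exists. *)

theory Defs
  imports
    Complex_Main
    "HOL-Library.FuncSet"
    "HOL-Library.Disjoint_Sets"
    "Jordan_Normal_Form.Matrix"
begin

text \<open>Finite simple graphs: a vertex set \<open>V\<close> and a set \<open>E\<close> of two-element subsets of \<open>V\<close>.\<close>

definition simple_graph :: "'v set \<Rightarrow> 'v set set \<Rightarrow> bool" where
  "simple_graph V E \<longleftrightarrow> finite V \<and> (\<forall>e\<in>E. e \<subseteq> V \<and> card e = 2)"

definition connected_graph :: "'v set \<Rightarrow> 'v set set \<Rightarrow> bool" where
  "connected_graph V E \<longleftrightarrow> (\<forall>u\<in>V. \<forall>v\<in>V. (u, v) \<in> {(x, y). {x, y} \<in> E}\<^sup>*)"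

definition edges_at :: "'v set set \<Rightarrow> 'v \<Rightarrow> 'v set set" where
  "edges_at E s = {e \<in> E. s \<in> e}"

definition inner_edges :: "'v set set \<Rightarrow> 'v set \<Rightarrow> 'v set set" where
  "inner_edges E R = {e \<in> E. e \<subseteq> R}"

definition leaving_edges :: "'v set set \<Rightarrow> 'v set \<Rightarrow> 'v set set" where
  "leaving_edges E R = {e \<in> E. e \<inter> R \<noteq> {} \<and> \<not> e \<subseteq> R}"

definition edges_between :: "'v set set \<Rightarrow> 'v set \<Rightarrow> 'v set \<Rightarrow> 'v set set" where
  "edges_between E R S = {e \<in> E. e \<inter> R \<noteq> {} \<and> e \<inter> S \<noteq> {}}"

text \<open>
  The bond space of an edge \<open>e\<close> is \<open>\<complex>\<close> to the power \<open>bond_dim P e\<close>, and the physical space of a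
  site \<open>s\<close> is \<open>\<complex>\<close> to the power \<open>d s\<close>.  The number \<open>site_tensor P s i p\<close> is the entry of the tensor
  at \<open>s\<close> with virtual indices \<open>i\<close> (one for each edge at \<open>s\<close>) and physical index \<open>p\<close>; only entries with
  \<open>i \<in> bond_indices P (edges_at E s)\<close> and \<open>p < d s\<close> are meaningful.
\<close>

record 'v peps =
  bond_dim :: "'v set \<Rightarrow> nat"
  site_tensor :: "'v \<Rightarrow> ('v set \<Rightarrow> nat) \<Rightarrow> nat \<Rightarrow> complex"

definition is_peps :: "'v set set \<Rightarrow> 'v peps \<Rightarrow> bool" where
  "is_peps E P \<longleftrightarrow> (\<forall>e\<in>E. bond_dim P e > 0)"

text \<open>
  Index sets of the product bases of the tensor product of the bond spaces of a set \<open>F\<close> of edges, and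
  of the tensor product of the physical spaces of a set \<open>R\<close> of sites.
\<close>

definition bond_indices :: "'v peps \<Rightarrow> 'v set set \<Rightarrow> ('v set \<Rightarrow> nat) set" where
  "bond_indices P F = (\<Pi>\<^sub>E e\<in>F. {..<bond_dim P e})"

definition phys_indices :: "('v \<Rightarrow> nat) \<Rightarrow> 'v set \<Rightarrow> ('v \<Rightarrow> nat) set" where
  "phys_indices d R = (\<Pi>\<^sub>E s\<in>R. {..<d s})"

text \<open>The coefficient of the generated state at the physical basis vector \<open>p\<close>.\<close>

definition peps_state :: "'v set \<Rightarrow> 'v set set \<Rightarrow> 'v peps \<Rightarrow> ('v \<Rightarrow> nat) \<Rightarrow> complex" where
  "peps_state V E P p =
     (\<Sum>k\<in>bond_indices P E. \<Prod>s\<in>V. site_tensor P s (restrict k (edges_at E s)) (p s))"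

definition same_state ::
  "'v set \<Rightarrow> 'v set set \<Rightarrow> ('v \<Rightarrow> nat) \<Rightarrow> 'v peps \<Rightarrow> 'v peps \<Rightarrow> bool" where
  "same_state V E d A B \<longleftrightarrow> (\<forall>p\<in>phys_indices d V. peps_state V E A p = peps_state V E B p)"

text \<open>
  In the blocked tensor the edges inside \<open>R\<close> carry the summed indices \<open>k\<close> and the edges leaving \<open>R\<close>
  the open indices \<open>i\<close>.
\<close>

definition blocked_tensor ::
  "'v set set \<Rightarrow> 'v peps \<Rightarrow> 'v set \<Rightarrow> ('v set \<Rightarrow> nat) \<Rightarrow> ('v \<Rightarrow> nat) \<Rightarrow> complex" where
  "blocked_tensor E P R i p =
     (\<Sum>k\<in>bond_indices P (inner_edges E R).
        \<Prod>s\<in>R. site_tensor P s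
          (restrict (\<lambda>e. if e \<subseteq> R then k e else i e) (edges_at E s)) (p s))"

text \<open>
  Vectors of the tensor product spaces are given by their coefficients, i.e. by the extensional
  complex functions on \<open>bond_indices P (leaving_edges E R)\<close> and on \<open>phys_indices d R\<close>.
\<close>

definition blocked_map ::
  "'v set set \<Rightarrow> ('v \<Rightarrow> nat) \<Rightarrow> 'v peps \<Rightarrow> 'v set \<Rightarrow>
     (('v set \<Rightarrow> nat) \<Rightarrow> complex) \<Rightarrow> (('v \<Rightarrow> nat) \<Rightarrow> complex)" where
  "blocked_map E d P R x =
     (\<lambda>p\<in>phys_indices d R.
        \<Sum>i\<in>bond_indices P (leaving_edges E R). blocked_tensor E P R i p * x i)"

definition injective_region ::
  "'v set \<Rightarrow> 'v set set \<Rightarrow> ('v \<Rightarrow> nat) \<Rightarrow> 'v peps \<Rightarrow> 'v set \<Rightarrow> bool" where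
  "injective_region V E d P R \<longleftrightarrow> R \<subseteq> V \<and>
     inj_on (blocked_map E d P R)
       (bond_indices P (leaving_edges E R) \<rightarrow>\<^sub>E (UNIV :: complex set))"

definition normal_peps :: "'v set \<Rightarrow> 'v set set \<Rightarrow> ('v \<Rightarrow> nat) \<Rightarrow> 'v peps \<Rightarrow> bool" where
  "normal_peps V E d P \<longleftrightarrow>
     (\<exists>\<R>. partition_on V \<R> \<and> (\<forall>R\<in>\<R>. injective_region V E d P R))"

text \<open>
  The three blocks form a ring \<open>R1\<close>, \<open>R2\<close>, \<open>R3\<close> whose bond between \<open>R1\<close> and \<open>R2\<close> is the single edge
  \<open>e\<close>.  The bonds to \<open>R3\<close> consist of all remaining edges between blocks; a bond without edges is
  one-dimensional.
\<close>

definition tripartite_injective_mps ::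
  "'v set \<Rightarrow> 'v set set \<Rightarrow> ('v \<Rightarrow> nat) \<Rightarrow> 'v peps \<Rightarrow> 'v set \<Rightarrow>
     'v set \<Rightarrow> 'v set \<Rightarrow> 'v set \<Rightarrow> bool" where
  "tripartite_injective_mps V E d P e R1 R2 R3 \<longleftrightarrow>
     R1 \<union> R2 \<union> R3 = V \<and> R1 \<inter> R2 = {} \<and> R1 \<inter> R3 = {} \<and> R2 \<inter> R3 = {} \<and>
     edges_between E R1 R2 = {e} \<and>
     injective_region V E d P R1 \<and> injective_region V E d P R2 \<and> injective_region V E d P R3"

definition injective_pair_at ::
  "'v set \<Rightarrow> 'v set set \<Rightarrow> ('v \<Rightarrow> nat) \<Rightarrow> 'v peps \<Rightarrow> 'v \<Rightarrow> 'v set \<Rightarrow> bool" where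
  "injective_pair_at V E d P s R \<longleftrightarrow> s \<notin> R \<and>
     injective_region V E d P R \<and> injective_region V E d P (insert s R) \<and>
     injective_region V E d P (V - R) \<and> injective_region V E d P (V - insert s R)"

text \<open>
  The tensor at \<open>s\<close> with the matrices \<open>Z e\<close> applied to its virtual indices: as a linear map from the
  virtual to the physical space it is precomposed with the tensor product of the \<open>Z e\<close>, where \<open>Z e\<close>
  maps into the bond space of \<open>P\<close> at \<open>e\<close>.
\<close>

definition apply_virtual ::
  "'v set set \<Rightarrow> 'v peps \<Rightarrow> 'v \<Rightarrow> ('v set \<Rightarrow> complex mat) \<Rightarrow> ('v set \<Rightarrow> nat) \<Rightarrow> nat \<Rightarrow> complex" where
  "apply_virtual E P s Z i p =
     (\<Sum>j\<in>bond_indices P (edges_at E s).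
        site_tensor P s j p * (\<Prod>e\<in>edges_at E s. Z e $$ (j e, i e)))"

text \<open>
  \<open>Z s e\<close> is the matrix applied at the end \<open>s\<close> of the edge \<open>e\<close>.  Contracting an edge sums over equal
  indices at its two ends, so the matrices at both ends act by left multiplication on their respective
  index, and they cancel iff one is the inverse of the transpose of the other.  (Turning one end into
  an input of the contraction replaces its matrix by the transpose; then the two are inverse.)
  The two PEPS may have different bond dimensions a priori; invertibility forces them to be equal.
\<close>

definition gauge_transformation ::
  "'v set \<Rightarrow> 'v set set \<Rightarrow> ('v \<Rightarrow> nat) \<Rightarrow> 'v peps \<Rightarrow> 'v peps \<Rightarrow>
     ('v \<Rightarrow> 'v set \<Rightarrow> complex mat) \<Rightarrow> bool" where
  "gauge_transformation V E d A B Z \<longleftrightarrow>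
     (\<forall>s\<in>V. \<forall>e\<in>edges_at E s.
        Z s e \<in> carrier_mat (bond_dim B e) (bond_dim A e) \<and> invertible_mat (Z s e)) \<and>
     (\<forall>u v. {u, v} \<in> E \<longrightarrow>
        inverts_mat (Z u {u, v}) (transpose_mat (Z v {u, v}))) \<and>
     (\<forall>s\<in>V. \<forall>i\<in>bond_indices A (edges_at E s). \<forall>p<d s.
        site_tensor A s i p = apply_virtual E B s (Z s) i p)"

end

theory Submission
  imports Defs "Jordan_Normal_Form.Determinant"
begin

text \<open>
  Cutting a state into two injective halves determines the bond space of the cut up to an invertible
  matrix.  In a ring of three injective blocks this can be done for the cuts around the first and around
  the second block; multiplying the two matrices along their common bond gives a multiple of the identity,
  so each of them acts on this bond by a matrix \<open>Z\<close> of its own.  Hence, for every edge, opening the edge in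
  \<open>A\<close> and in \<open>B\<close> yields the same family of states up to \<open>Z\<close>.

  This relation no longer refers to the tripartition, so it may be used in any other cut \<open>R\<close>: the matrix of
  that cut factorises bond by bond and equals the product of the matrices \<open>Z\<close> up to a scalar.  Comparing
  the blocks \<open>R\<close> and \<open>insert s R\<close> and inverting the injective block \<open>R\<close> gives \<open>A\<^sub>s = c\<^sub>s B\<^sub>s(\<Otimes> Z)\<close>.  The scalars
  \<open>c\<^sub>s\<close> multiply to 1, as the state is nonzero, and connectedness allows them to be moved into the edges.

  For uniqueness, two gauges give equal products of matrices on the bonds leaving an injective region,
  and the factors of a nonzero tensor product are unique up to scalars.
\<close>

section \<open>Left inverses and bipartite cuts\<close>

text \<open>The obstacle is that the two hypotheses supply unrelated regions: tripartitions produce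
  the bond matrices, the pairs \<open>R\<close>, \<open>insert s R\<close> isolate a site, and their
  boundaries need not agree. What links them is the state with one edge opened and arbitrary indices
  on its two loose ends: it depends on the edge alone, and every region that the edge leaves sees
  the same object. The identity in a ring has the following source. In \<open>B\<close>, the
  complement of the first block at bond index \<open>y\<close> contains the second tensor only at
  \<open>y\<close>; rewritten through \<open>A\<close> it becomes a combination over all indices
  \<open>y'\<close>. Independence of the second tensor kills the terms with \<open>y'\<close>
  different from \<open>y\<close>. The bond dimensions may differ at first: the identity gives a
  right inverse, hence one inequality, and exchanging \<open>A\<close> and \<open>B\<close> gives
  the other. Each \<open>c\<^sub>s\<close> is the ratio of the scalars belonging to
  \<open>insert s R\<close> and \<open>R\<close>. Moving these numbers into the edges is a
  multiplicative flow problem, solvable on a connected graph because their product is 1.\<close>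

lemma sum_mult_delta:
  fixes f :: "'a \<Rightarrow> complex"
  assumes "finite S" and "y \<in> S"
  shows "(\<Sum>x\<in>S. f x * of_bool (x = y)) = f y" and "(\<Sum>x\<in>S. f x * of_bool (y = x)) = f y"
    and "(\<Sum>x\<in>S. of_bool (x = y) * f x) = f y" and "(\<Sum>x\<in>S. of_bool (y = x) * f x) = f y"
  using assms by (simp_all add: of_bool_def if_distrib if_distribR cong: if_cong)

text \<open>Linear independence of the vectors \<open>T i\<close>, stated by an explicit left
  inverse, since this is what gets contracted with a physical index, and since left inverses of two
  tensors multiply to one of their contraction.\<close>

definition left_invertible_on :: "'i set \<Rightarrow> 'p set \<Rightarrow> ('i \<Rightarrow> 'p \<Rightarrow> complex) \<Rightarrow> bool" where
  "left_invertible_on I P T \<longleftrightarrow>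
     (\<exists>L. \<forall>i\<in>I. \<forall>j\<in>I. (\<Sum>p\<in>P. L j p * T i p) = of_bool (i = j))"

lemma left_invertible_onE:
  assumes "left_invertible_on I P T"
  obtains L where "\<And>i j. i \<in> I \<Longrightarrow> j \<in> I \<Longrightarrow> (\<Sum>p\<in>P. L j p * T i p) = of_bool (i = j)"
  using assms unfolding left_invertible_on_def by blast

lemma left_invertible_onI:
  assumes "\<And>i j. i \<in> I \<Longrightarrow> j \<in> I \<Longrightarrow> (\<Sum>p\<in>P. L j p * T i p) = of_bool (i = j)"
  shows "left_invertible_on I P T"
  unfolding left_invertible_on_def using assms by blast

lemma left_inverse_sum:
  fixes x :: "'i \<Rightarrow> complex"
  assumes "finite I" and "j \<in> I"
    and L: "\<And>i j. i \<in> I \<Longrightarrow> j \<in> I \<Longrightarrow> (\<Sum>p\<in>P. L j p * T i p) = of_bool (i = j)"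
  shows "(\<Sum>p\<in>P. L j p * (\<Sum>i\<in>I. x i * T i p)) = x j"
proof -
  have "(\<Sum>p\<in>P. L j p * (\<Sum>i\<in>I. x i * T i p)) = (\<Sum>i\<in>I. x i * (\<Sum>p\<in>P. L j p * T i p))"
    unfolding sum_distrib_left by (subst sum.swap) (simp add: mult_ac)
  also have "\<dots> = (\<Sum>i\<in>I. x i * of_bool (i = j))"
    using L[OF _ assms(2)] by simp
  finally show ?thesis
    using assms by (simp add: sum_mult_delta)
qed

lemma left_invertible_on_cancel:
  fixes x y :: "'i \<Rightarrow> complex"
  assumes "left_invertible_on I P T" and "finite I" and "i \<in> I"
    and "\<And>p. p \<in> P \<Longrightarrow> (\<Sum>i\<in>I. x i * T i p) = (\<Sum>i\<in>I. y i * T i p)"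
  shows "x i = y i"
proof -
  obtain L where L: "\<And>i j. i \<in> I \<Longrightarrow> j \<in> I \<Longrightarrow> (\<Sum>p\<in>P. L j p * T i p) = of_bool (i = j)"
    using assms(1) by (rule left_invertible_onE) blast
  have "x i = (\<Sum>p\<in>P. L i p * (\<Sum>i\<in>I. x i * T i p))"
    using left_inverse_sum[OF assms(2,3), where P = P and L = L and T = T and x = x] L by simp
  also have "\<dots> = (\<Sum>p\<in>P. L i p * (\<Sum>i\<in>I. y i * T i p))"
    using assms(4) by simp
  also have "\<dots> = y i"
    using left_inverse_sum[OF assms(2,3), where P = P and L = L and T = T and x = y] L by simp
  finally show ?thesis .
qed

lemma left_invertible_on_nonzero:
  assumes "left_invertible_on I P T" and "i \<in> I"
  shows "\<exists>p\<in>P. T i p \<noteq> 0"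
proof (rule ccontr)
  assume neg: "\<not> (\<exists>p\<in>P. T i p \<noteq> 0)"
  obtain L where "\<And>i j. i \<in> I \<Longrightarrow> j \<in> I \<Longrightarrow> (\<Sum>p\<in>P. L j p * T i p) = of_bool (i = j)"
    using assms(1) by (rule left_invertible_onE) blast
  from this[OF assms(2) assms(2)] neg show False by simp
qed

lemma left_invertible_on_reindex:
  assumes "left_invertible_on J P T" and "inj_on g I" and "g ` I \<subseteq> J"
  shows "left_invertible_on I P (\<lambda>i. T (g i))"
proof -
  obtain L where L: "\<And>i j. i \<in> J \<Longrightarrow> j \<in> J \<Longrightarrow> (\<Sum>p\<in>P. L j p * T i p) = of_bool (i = j)"
    using assms(1) by (rule left_invertible_onE) blast
  show ?thesis
  proof (rule left_invertible_onI[where L = "\<lambda>j. L (g j)"])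
    fix i j assume ij: "i \<in> I" "j \<in> I"
    then have "g i = g j \<longleftrightarrow> i = j" using assms(2) by (auto dest: inj_onD)
    with ij show "(\<Sum>p\<in>P. L (g j) p * T (g i) p) = of_bool (i = j)"
      using L[of "g i" "g j"] assms(3) by (auto simp: image_subset_iff)
  qed
qed

text \<open>The inverse is built one column at a time: a new independent column \<open>T i0\<close> has a nonzero
  residual \<open>r\<close> modulo the others, and an entry \<open>r p0 \<noteq> 0\<close> is used as the pivot.\<close>

lemma left_invertible_on_if_independent:
  assumes "finite I" and "finite P"
    and "\<And>x. (\<And>p. p \<in> P \<Longrightarrow> (\<Sum>i\<in>I. T i p * x i) = 0) \<Longrightarrow> (\<And>i. i \<in> I \<Longrightarrow> x i = 0)"
  shows "left_invertible_on I P T"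
  using assms(1,3)
proof (induction I)
  case empty
  show ?case by (simp add: left_invertible_on_def)
next
  case (insert i0 I)
  have "left_invertible_on I P T"
  proof (rule insert.IH)
    fix x i assume x: "\<And>p. p \<in> P \<Longrightarrow> (\<Sum>i\<in>I. T i p * x i) = 0" and i: "i \<in> I"
    have "(\<Sum>i\<in>insert i0 I. T i p * (x(i0 := 0)) i) = 0" if "p \<in> P" for p
    proof -
      have "(\<Sum>i\<in>I. T i p * (x(i0 := 0)) i) = (\<Sum>i\<in>I. T i p * x i)"
        using insert.hyps by (intro sum.cong) auto
      then show ?thesis using x[OF that] insert.hyps by simp
    qed
    from insert.prems[OF this, of i] i insert.hyps show "x i = 0" by (auto split: if_splits)
  qed
  then obtain L where L: "\<And>i j. i \<in> I \<Longrightarrow> j \<in> I \<Longrightarrow> (\<Sum>p\<in>P. L j p * T i p) = of_bool (i = j)"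
    by (rule left_invertible_onE) blast
  define c where "c i = (\<Sum>q\<in>P. L i q * T i0 q)" for i
  define r where "r p = T i0 p - (\<Sum>i\<in>I. c i * T i p)" for p
  have "\<exists>p0\<in>P. r p0 \<noteq> 0"
  proof (rule ccontr)
    assume "\<not> (\<exists>p0\<in>P. r p0 \<noteq> 0)"
    then have "(\<Sum>i\<in>insert i0 I. T i p * (if i = i0 then 1 else - c i)) = 0" if "p \<in> P" for p
    proof -
      have "(\<Sum>i\<in>I. T i p * (if i = i0 then 1 else - c i)) = - (\<Sum>i\<in>I. c i * T i p)"
        unfolding sum_negf[symmetric] using insert.hyps by (intro sum.cong) auto
      moreover have "r p = 0" using \<open>\<not> (\<exists>p0\<in>P. r p0 \<noteq> 0)\<close> that by blast
      ultimately show ?thesis using insert.hyps by (simp add: r_def)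
    qed
    from insert.prems[OF this, of i0] show False by simp
  qed
  then obtain p0 where p0: "p0 \<in> P" "r p0 \<noteq> 0" by blast
  \<comment> \<open>\<open>f\<close> takes the entry at \<open>p0\<close> of the residual of a
    vector modulo the old columns and divides by \<open>r p0\<close>. It therefore vanishes on the
    old columns and is 1 on \<open>T i0\<close>.\<close>
  define f where "f p = (of_bool (p = p0) - (\<Sum>i\<in>I. T i p0 * L i p)) / r p0" for p
  have f_sum: "(\<Sum>p\<in>P. f p * y p) = (y p0 - (\<Sum>i\<in>I. T i p0 * (\<Sum>p\<in>P. L i p * y p))) / r p0" for y
  proof -
    have "(\<Sum>p\<in>P. f p * y p)
        = ((\<Sum>p\<in>P. of_bool (p = p0) * y p) - (\<Sum>p\<in>P. (\<Sum>i\<in>I. T i p0 * L i p) * y p)) / r p0"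
      unfolding f_def by (simp add: sum_subtractf left_diff_distrib diff_divide_distrib
          flip: sum_divide_distrib)
    also have "(\<Sum>p\<in>P. (\<Sum>i\<in>I. T i p0 * L i p) * y p) = (\<Sum>i\<in>I. T i p0 * (\<Sum>p\<in>P. L i p * y p))"
      unfolding sum_distrib_left sum_distrib_right by (subst sum.swap) (simp add: mult_ac)
    finally show ?thesis using p0 assms(2) by (simp add: sum_mult_delta)
  qed
  have f_I: "(\<Sum>p\<in>P. f p * T i p) = 0" if "i \<in> I" for i
  proof -
    have "(\<Sum>k\<in>I. T k p0 * (\<Sum>p\<in>P. L k p * T i p)) = (\<Sum>k\<in>I. T k p0 * of_bool (i = k))"
      using L that by simp
    then show ?thesis using that insert.hyps unfolding f_sum by (simp add: sum_mult_delta)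
  qed
  have f_i0: "(\<Sum>p\<in>P. f p * T i0 p) = 1"
    unfolding f_sum using p0 by (simp add: c_def[symmetric] r_def mult.commute)
  \<comment> \<open>The old functional \<open>L j\<close> has the value \<open>c j\<close> on the
    new column; subtracting \<open>c j * f\<close> removes it without changing the values on the old
    columns.\<close>
  define L' where "L' j p = (if j = i0 then f p else L j p - c j * f p)" for j p
  show ?case
  proof (rule left_invertible_onI[where L = L'])
    fix i j assume ij: "i \<in> insert i0 I" "j \<in> insert i0 I"
    show "(\<Sum>p\<in>P. L' j p * T i p) = of_bool (i = j)"
    proof (cases "j = i0")
      case True
      then show ?thesis using ij f_I f_i0 by (auto simp: L'_def)
    next
      case False
      then have "(\<Sum>p\<in>P. L' j p * T i p)
          = (\<Sum>p\<in>P. L j p * T i p) - c j * (\<Sum>p\<in>P. f p * T i p)"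
        by (simp add: L'_def left_diff_distrib sum_subtractf sum_distrib_left mult.assoc)
      then show ?thesis using ij False f_I f_i0 L
        by (cases "i = i0") (auto simp: c_def)
    qed
  qed
qed

text \<open>A left inverse of \<open>a'\<close> applied to the second half isolates each
  \<open>a i\<close> as a combination of the \<open>b j\<close>. Substituting this into the state
  and cancelling the independent \<open>b j\<close> yields the relation between the other halves
  with the same matrix.\<close>

lemma bipartite_gauge:
  fixes a :: "'i \<Rightarrow> 'p \<Rightarrow> complex" and a' :: "'i \<Rightarrow> 'q \<Rightarrow> complex"
  assumes "finite I" and "finite J"
    and "left_invertible_on J P b" and "left_invertible_on I Q a'"
    and eq: "\<And>p q. p \<in> P \<Longrightarrow> q \<in> Q \<Longrightarrow>
      (\<Sum>i\<in>I. a i p * a' i q) = (\<Sum>j\<in>J. b j p * b' j q)"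
  obtains W where "\<And>i p. i \<in> I \<Longrightarrow> p \<in> P \<Longrightarrow> a i p = (\<Sum>j\<in>J. W j i * b j p)"
    and "\<And>j q. j \<in> J \<Longrightarrow> q \<in> Q \<Longrightarrow> b' j q = (\<Sum>i\<in>I. W j i * a' i q)"
proof -
  obtain L where L: "\<And>i j. i \<in> J \<Longrightarrow> j \<in> J \<Longrightarrow> (\<Sum>p\<in>P. L j p * b i p) = of_bool (i = j)"
    using assms(3) by (rule left_invertible_onE) blast
  obtain L' where L': "\<And>i j. i \<in> I \<Longrightarrow> j \<in> I \<Longrightarrow> (\<Sum>p\<in>Q. L' j p * a' i p) = of_bool (i = j)"
    using assms(4) by (rule left_invertible_onE) blast
  define W where "W j i = (\<Sum>q\<in>Q. L' i q * b' j q)" for j i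
  have a: "a i p = (\<Sum>j\<in>J. W j i * b j p)" if "i \<in> I" "p \<in> P" for i p
  proof -
    have "a i p = (\<Sum>q\<in>Q. L' i q * (\<Sum>i\<in>I. a i p * a' i q))"
      using left_inverse_sum[OF assms(1) that(1), where P = Q and L = L' and T = a'] L' by simp
    also have "\<dots> = (\<Sum>q\<in>Q. L' i q * (\<Sum>j\<in>J. b j p * b' j q))"
      using eq that by simp
    also have "\<dots> = (\<Sum>j\<in>J. W j i * b j p)"
      unfolding sum_distrib_left sum_distrib_right W_def by (subst sum.swap) (simp add: mult_ac)
    finally show ?thesis .
  qed
  have b': "b' j q = (\<Sum>i\<in>I. W j i * a' i q)" if "j \<in> J" "q \<in> Q" for j q
  proof -
    have "b' j q = (\<Sum>p\<in>P. L j p * (\<Sum>j\<in>J. b' j q * b j p))"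
      using left_inverse_sum[OF assms(2) that(1), where P = P and L = L and T = b] L by simp
    also have "\<dots> = (\<Sum>p\<in>P. L j p * (\<Sum>i\<in>I. a i p * a' i q))"
      using eq that by (simp add: mult.commute)
    also have "\<dots> = (\<Sum>p\<in>P. L j p * (\<Sum>k\<in>J. (\<Sum>i\<in>I. W k i * a' i q) * b k p))"
    proof (intro sum.cong refl arg_cong2[where f = "(*)"])
      fix p assume "p \<in> P"
      then have "(\<Sum>i\<in>I. a i p * a' i q) = (\<Sum>i\<in>I. (\<Sum>k\<in>J. W k i * b k p) * a' i q)"
        by (simp add: a)
      also have "\<dots> = (\<Sum>k\<in>J. (\<Sum>i\<in>I. W k i * a' i q) * b k p)"
        unfolding sum_distrib_right by (subst sum.swap) (simp add: mult_ac)
      finally show "(\<Sum>i\<in>I. a i p * a' i q) = (\<Sum>k\<in>J. (\<Sum>i\<in>I. W k i * a' i q) * b k p)" .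
    qed
    also have "\<dots> = (\<Sum>i\<in>I. W j i * a' i q)"
      using left_inverse_sum[OF assms(2) that(1), where P = P and L = L and T = b and x = "\<lambda>k. \<Sum>i\<in>I. W k i * a' i q"] L by simp
    finally show ?thesis .
  qed
  show thesis using a b' by (rule that)
qed

section \<open>Rings of three injective tensors\<close>

lemma sum_swap3:
  "(\<Sum>x\<in>A. \<Sum>y\<in>B. \<Sum>z\<in>C. f x y z) = (\<Sum>z\<in>C. \<Sum>y\<in>B. \<Sum>x\<in>A. f x y z)"
proof -
  have "(\<Sum>x\<in>A. \<Sum>y\<in>B. \<Sum>z\<in>C. f x y z) = (\<Sum>y\<in>B. \<Sum>x\<in>A. \<Sum>z\<in>C. f x y z)"
    by (rule sum.swap)
  also have "\<dots> = (\<Sum>y\<in>B. \<Sum>z\<in>C. \<Sum>x\<in>A. f x y z)"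
    by (intro sum.cong refl sum.swap)
  also have "\<dots> = (\<Sum>z\<in>C. \<Sum>y\<in>B. \<Sum>x\<in>A. f x y z)"
    by (rule sum.swap)
  finally show ?thesis .
qed

text \<open>The product of the two left inverses works once the contracted index is frozen to one
  \<open>g0\<close> in both: only the term \<open>g = g0\<close> survives. Summing over all of
  \<open>G\<close> instead would produce a factor \<open>card G\<close>.\<close>

lemma left_invertible_on_contract:
  fixes a :: "'x \<Rightarrow> 'g \<Rightarrow> 'q \<Rightarrow> complex" and c :: "'f \<Rightarrow> 'g \<Rightarrow> 'r \<Rightarrow> complex"
  assumes "finite G" and "G \<noteq> {}"
    and "left_invertible_on (X \<times> G) Q (\<lambda>(x, g). a x g)"
    and "left_invertible_on (F \<times> G) R (\<lambda>(f, g). c f g)"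
  shows "left_invertible_on (X \<times> F) (Q \<times> R) (\<lambda>(x, f) (q, r). \<Sum>g\<in>G. a x g q * c f g r)"
proof -
  obtain g0 where g0: "g0 \<in> G" using assms(2) by blast
  obtain L where L: "\<And>i j. i \<in> X \<times> G \<Longrightarrow> j \<in> X \<times> G \<Longrightarrow>
      (\<Sum>q\<in>Q. L j q * (\<lambda>(x, g). a x g) i q) = of_bool (i = j)"
    using assms(3) by (rule left_invertible_onE) blast
  obtain M where M: "\<And>i j. i \<in> F \<times> G \<Longrightarrow> j \<in> F \<times> G \<Longrightarrow>
      (\<Sum>r\<in>R. M j r * (\<lambda>(f, g). c f g) i r) = of_bool (i = j)"
    using assms(4) by (rule left_invertible_onE) blast
  show ?thesis
  proof (rule left_invertible_onI[where L = "\<lambda>(x, f) (q, r). L (x, g0) q * M (f, g0) r"])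
    fix i j assume "i \<in> X \<times> F" "j \<in> X \<times> F"
    then obtain x f x' f' where ij: "i = (x, f)" "j = (x', f')" "x \<in> X" "f \<in> F" "x' \<in> X" "f' \<in> F"
      by auto
    have "(\<Sum>s\<in>Q \<times> R. (case j of (x, f) \<Rightarrow> \<lambda>(q, r). L (x, g0) q * M (f, g0) r) s
          * (case i of (x, f) \<Rightarrow> \<lambda>(q, r). \<Sum>g\<in>G. a x g q * c f g r) s)
        = (\<Sum>s\<in>Q \<times> R. \<Sum>g\<in>G. (L (x', g0) (fst s) * a x g (fst s)) * (M (f', g0) (snd s) * c f g (snd s)))"
      by (simp add: ij case_prod_unfold sum_distrib_left mult_ac)
    also have "\<dots> = (\<Sum>g\<in>G. (\<Sum>q\<in>Q. L (x', g0) q * a x g q) * (\<Sum>r\<in>R. M (f', g0) r * c f g r))"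
      by (subst sum.swap) (simp add: sum_product sum.cartesian_product case_prod_unfold)
    also have "\<dots> = (\<Sum>g\<in>G. of_bool (x = x' \<and> f = f') * of_bool (g = g0))"
      using L[of "(_, _)" "(x', g0)"] M[of "(_, _)" "(f', g0)"] ij g0
      by (intro sum.cong) (auto simp: of_bool_def)
    also have "\<dots> = of_bool (x = x' \<and> f = f')"
      using g0 assms(1) by (simp add: sum_mult_delta)
    finally show "(\<Sum>s\<in>Q \<times> R. (case j of (x, f) \<Rightarrow> \<lambda>(q, r). L (x, g0) q * M (f, g0) r) s
          * (case i of (x, f) \<Rightarrow> \<lambda>(q, r). \<Sum>g\<in>G. a x g q * c f g r) s) = of_bool (i = j)"
      by (simp add: ij)
  qed
qed

text \<open>A ring of three injective tensors: the bond \<open>X\<close> joins the first and second, \<open>F\<close> the first and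
  third, \<open>G\<close> the second and third; \<open>P\<close>, \<open>Q\<close>, \<open>R\<close> index the physical spaces.\<close>

locale injective_ring =
  fixes X :: "'x set" and F :: "'f set" and G :: "'g set"
    and P :: "'p set" and Q :: "'q set" and R :: "'r set"
    and a1 :: "'x \<Rightarrow> 'f \<Rightarrow> 'p \<Rightarrow> complex"
    and a2 :: "'x \<Rightarrow> 'g \<Rightarrow> 'q \<Rightarrow> complex"
    and a3 :: "'f \<Rightarrow> 'g \<Rightarrow> 'r \<Rightarrow> complex"
  assumes finite: "finite X" "finite F" "finite G"
    and nonempty: "X \<noteq> {}" "F \<noteq> {}" "G \<noteq> {}"
    and left_invertible: "left_invertible_on (X \<times> F) P (\<lambda>(x, f). a1 x f)"
      "left_invertible_on (X \<times> G) Q (\<lambda>(x, g). a2 x g)"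
      "left_invertible_on (F \<times> G) R (\<lambda>(f, g). a3 f g)"
begin

definition rest1 :: "'x \<Rightarrow> 'f \<Rightarrow> 'q \<Rightarrow> 'r \<Rightarrow> complex" where
  "rest1 x f q r = (\<Sum>g\<in>G. a2 x g q * a3 f g r)"

definition rest2 :: "'x \<Rightarrow> 'g \<Rightarrow> 'p \<Rightarrow> 'r \<Rightarrow> complex" where
  "rest2 x g p r = (\<Sum>f\<in>F. a1 x f p * a3 f g r)"

text \<open>The bond \<open>X\<close> is opened, with \<open>x\<close> on the end of the first
  tensor and \<open>y\<close> on that of the second; a matrix inserted on the bond is a combination
  of these.\<close>

definition cut_state :: "'x \<Rightarrow> 'x \<Rightarrow> 'p \<Rightarrow> 'q \<Rightarrow> 'r \<Rightarrow> complex" where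
  "cut_state x y p q r = (\<Sum>f\<in>F. a1 x f p * rest1 y f q r)"

definition state :: "'p \<Rightarrow> 'q \<Rightarrow> 'r \<Rightarrow> complex" where
  "state p q r = (\<Sum>x\<in>X. cut_state x x p q r)"

lemma left_invertible_rest:
  "left_invertible_on (X \<times> F) (Q \<times> R) (\<lambda>(x, f) (q, r). rest1 x f q r)"
  "left_invertible_on (X \<times> G) (P \<times> R) (\<lambda>(x, g) (p, r). rest2 x g p r)"
proof -
  show "left_invertible_on (X \<times> F) (Q \<times> R) (\<lambda>(x, f) (q, r). rest1 x f q r)"
    unfolding rest1_def
    by (rule left_invertible_on_contract) (use finite nonempty left_invertible in auto)
  have "left_invertible_on (G \<times> F) R (\<lambda>i. (\<lambda>(f, g). a3 f g) (prod.swap i))"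
    by (rule left_invertible_on_reindex[OF left_invertible(3)]) auto
  then have "left_invertible_on (G \<times> F) R (\<lambda>(g, f). a3 f g)"
    by (simp add: case_prod_unfold)
  then show "left_invertible_on (X \<times> G) (P \<times> R) (\<lambda>(x, g) (p, r). rest2 x g p r)"
    unfolding rest2_def
    by (intro left_invertible_on_contract) (use finite nonempty left_invertible in auto)
qed

lemma state_cut1: "state p q r = (\<Sum>(x, f)\<in>X \<times> F. a1 x f p * rest1 x f q r)"
  by (simp add: state_def cut_state_def sum.cartesian_product)

lemma state_cut2: "state p q r = (\<Sum>(x, g)\<in>X \<times> G. a2 x g q * rest2 x g p r)"
proof -
  have "(\<Sum>f\<in>F. a1 x f p * rest1 x f q r) = (\<Sum>g\<in>G. a2 x g q * rest2 x g p r)" for x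
    unfolding rest1_def rest2_def sum_distrib_left by (subst sum.swap) (simp add: mult_ac)
  then show ?thesis
    by (simp add: state_def cut_state_def sum.cartesian_product[symmetric])
qed

end

locale injective_ring_pair =
  A: injective_ring X F G P Q R a1 a2 a3 + B: injective_ring Y F' G' P Q R b1 b2 b3
  for X :: "'x set" and F :: "'f set" and G :: "'g set"
    and Y :: "'y set" and F' :: "'h set" and G' :: "'k set"
    and P :: "'p set" and Q :: "'q set" and R :: "'r set"
    and a1 a2 a3 b1 b2 b3 +
  assumes same_state: "p \<in> P \<Longrightarrow> q \<in> Q \<Longrightarrow> r \<in> R \<Longrightarrow> A.state p q r = B.state p q r"
begin

text \<open>\<open>W\<close> and \<open>U\<close> are the gauges of the two bipartite cuts that separate off the first and the second
  tensor; contracting them along \<open>X\<close> yields the identity of \<open>Y\<close> up to scalars \<open>\<tau>\<close>.\<close>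

lemma cut_gauges:
  obtains W U \<tau> where
    "\<And>x f p. x \<in> X \<Longrightarrow> f \<in> F \<Longrightarrow> p \<in> P \<Longrightarrow> a1 x f p = (\<Sum>y\<in>Y. \<Sum>h\<in>F'. W y h x f * b1 y h p)"
    "\<And>y h q r. y \<in> Y \<Longrightarrow> h \<in> F' \<Longrightarrow> q \<in> Q \<Longrightarrow> r \<in> R \<Longrightarrow>
      B.rest1 y h q r = (\<Sum>x\<in>X. \<Sum>f\<in>F. W y h x f * A.rest1 x f q r)"
    "\<And>y y' h k f g. y \<in> Y \<Longrightarrow> y' \<in> Y \<Longrightarrow> h \<in> F' \<Longrightarrow> k \<in> G' \<Longrightarrow> f \<in> F \<Longrightarrow> g \<in> G \<Longrightarrow>
      (\<Sum>x\<in>X. W y h x f * U y' k x g) = of_bool (y = y') * \<tau> h k f g"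
    "\<exists>h\<in>F'. \<exists>k\<in>G'. \<exists>f\<in>F. \<exists>g\<in>G. \<tau> h k f g \<noteq> (0::complex)"
proof -
  have fin: "finite (X \<times> F)" "finite (Y \<times> F')" "finite (X \<times> G)" "finite (Y \<times> G')"
    using A.finite B.finite by auto
  obtain W0 where W0: "\<And>i p. i \<in> X \<times> F \<Longrightarrow> p \<in> P \<Longrightarrow>
        (\<lambda>(x, f). a1 x f) i p = (\<Sum>j\<in>Y \<times> F'. W0 j i * (\<lambda>(y, h). b1 y h) j p)"
      and W0': "\<And>j s. j \<in> Y \<times> F' \<Longrightarrow> s \<in> Q \<times> R \<Longrightarrow> (\<lambda>(y, h) (q, r). B.rest1 y h q r) j s
        = (\<Sum>i\<in>X \<times> F. W0 j i * (\<lambda>(x, f) (q, r). A.rest1 x f q r) i s)"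
  proof (rule bipartite_gauge[OF fin(1,2) B.left_invertible(1) A.left_invertible_rest(1)])
    fix p s assume "p \<in> P" "s \<in> Q \<times> R"
    then show "(\<Sum>i\<in>X \<times> F. (\<lambda>(x, f). a1 x f) i p * (\<lambda>(x, f) (q, r). A.rest1 x f q r) i s)
        = (\<Sum>j\<in>Y \<times> F'. (\<lambda>(y, h). b1 y h) j p * (\<lambda>(y, h) (q, r). B.rest1 y h q r) j s)"
      using same_state[of p "fst s" "snd s"] unfolding A.state_cut1 B.state_cut1
      by (auto simp: case_prod_unfold)
  qed blast
  obtain U0 where U0: "\<And>i p. i \<in> X \<times> G \<Longrightarrow> p \<in> Q \<Longrightarrow>
        (\<lambda>(x, f). a2 x f) i p = (\<Sum>j\<in>Y \<times> G'. U0 j i * (\<lambda>(y, h). b2 y h) j p)"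
  proof (rule bipartite_gauge[OF fin(3,4) B.left_invertible(2) A.left_invertible_rest(2)])
    fix q s assume "q \<in> Q" "s \<in> P \<times> R"
    then show "(\<Sum>i\<in>X \<times> G. (\<lambda>(x, g). a2 x g) i q * (\<lambda>(x, g) (p, r). A.rest2 x g p r) i s)
        = (\<Sum>j\<in>Y \<times> G'. (\<lambda>(y, k). b2 y k) j q * (\<lambda>(y, k) (p, r). B.rest2 y k p r) j s)"
      using same_state[of "fst s" q "snd s"] unfolding A.state_cut2 B.state_cut2
      by (auto simp: case_prod_unfold)
  qed blast
  define W where "W y h x f = W0 (y, h) (x, f)" for y h x f
  define U where "U y k x g = U0 (y, k) (x, g)" for y k x g
  have W1: "a1 x f p = (\<Sum>y\<in>Y. \<Sum>h\<in>F'. W y h x f * b1 y h p)"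
    if "x \<in> X" "f \<in> F" "p \<in> P" for x f p
    using W0[of "(x, f)" p] that by (simp add: W_def sum.cartesian_product case_prod_unfold)
  have W2: "B.rest1 y h q r = (\<Sum>x\<in>X. \<Sum>f\<in>F. W y h x f * A.rest1 x f q r)"
    if "y \<in> Y" "h \<in> F'" "q \<in> Q" "r \<in> R" for y h q r
    using W0'[of "(y, h)" "(q, r)"] that by (simp add: W_def sum.cartesian_product case_prod_unfold)
  have U1: "a2 x g q = (\<Sum>(y, k)\<in>Y \<times> G'. U y k x g * b2 y k q)"
    if "x \<in> X" "g \<in> G" "q \<in> Q" for x g q
    using U0[of "(x, g)" q] that by (simp add: U_def case_prod_unfold)
  obtain L where L: "\<And>i j. i \<in> F \<times> G \<Longrightarrow> j \<in> F \<times> G \<Longrightarrow>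
      (\<Sum>r\<in>R. L j r * (\<lambda>(f, g). a3 f g) i r) = of_bool (i = j)"
    using A.left_invertible(3) by (rule left_invertible_onE) blast
  \<comment> \<open>The coordinates of \<open>b3 h k\<close> in the independent family
    \<open>a3 f g\<close>, read off with its left inverse.\<close>
  define \<tau> where "\<tau> h k f g = (\<Sum>r\<in>R. L (f, g) r * b3 h k r)" for h k f g
  \<comment> \<open>\<open>B.rest1 y h\<close> is expanded in two ways along the family
    \<open>b2 y' k\<close>: by its definition, where only \<open>y' = y\<close> occurs, and through
    \<open>W\<close> and \<open>U\<close> by way of \<open>A\<close>. Comparing coefficients gives
    the claim.\<close>
  have b3: "of_bool (y = y') * b3 h k r = (\<Sum>(f, g)\<in>F \<times> G. (\<Sum>x\<in>X. W y h x f * U y' k x g) * a3 f g r)"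
    if "y \<in> Y" "y' \<in> Y" "h \<in> F'" "k \<in> G'" "r \<in> R" for y y' h k r
  proof -
    let ?T = "\<lambda>(y', k). \<Sum>(f, g)\<in>F \<times> G. (\<Sum>x\<in>X. W y h x f * U y' k x g) * a3 f g r"
    have "(\<lambda>(y', k). of_bool (y = y') * b3 h k r) (y', k) = ?T (y', k)"
    proof (rule left_invertible_on_cancel[OF B.left_invertible(2) fin(4)])
      show "(y', k) \<in> Y \<times> G'" using that by simp
      fix q assume q: "q \<in> Q"
      have "(\<Sum>i\<in>Y \<times> G'. (\<lambda>(y', k). of_bool (y = y') * b3 h k r) i * (\<lambda>(y, k). b2 y k) i q)
          = (\<Sum>k\<in>G'. \<Sum>y'\<in>Y. of_bool (y = y') * (b2 y' k q * b3 h k r))"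
        by (subst sum.swap) (simp add: sum.cartesian_product case_prod_unfold mult_ac)
      also have "\<dots> = B.rest1 y h q r"
        using that B.finite by (simp add: sum_mult_delta B.rest1_def)
      also have "\<dots> = (\<Sum>x\<in>X. \<Sum>c\<in>F \<times> G. W y h x (fst c) * (a2 x (snd c) q * a3 (fst c) (snd c) r))"
        using W2[OF that(1,3) q that(5)]
        by (simp add: A.rest1_def sum_distrib_left sum.cartesian_product case_prod_unfold)
      also have "\<dots> = (\<Sum>x\<in>X. \<Sum>c\<in>F \<times> G. \<Sum>j\<in>Y \<times> G'.
          W y h x (fst c) * U (fst j) (snd j) x (snd c) * a3 (fst c) (snd c) r * b2 (fst j) (snd j) q)"
        using U1[OF _ _ q]
        by (intro sum.cong refl) (auto simp: sum_distrib_left sum_distrib_right mult_ac case_prod_unfold)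
      also have "\<dots> = (\<Sum>i\<in>Y \<times> G'. ?T i * (\<lambda>(y, k). b2 y k) i q)"
        by (subst sum_swap3) (simp add: sum_distrib_right case_prod_unfold)
      finally show "(\<Sum>i\<in>Y \<times> G'. (\<lambda>(y', k). of_bool (y = y') * b3 h k r) i * (\<lambda>(y, k). b2 y k) i q)
          = (\<Sum>i\<in>Y \<times> G'. ?T i * (\<lambda>(y, k). b2 y k) i q)" .
    qed
    then show ?thesis by simp
  qed
  have \<tau>: "(\<Sum>x\<in>X. W y h x f * U y' k x g) = of_bool (y = y') * \<tau> h k f g"
    if "y \<in> Y" "y' \<in> Y" "h \<in> F'" "k \<in> G'" "f \<in> F" "g \<in> G" for y y' h k f g
  proof -
    have "(\<Sum>x\<in>X. W y h x f * U y' k x g)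
        = (\<Sum>r\<in>R. L (f, g) r * (\<Sum>i\<in>F \<times> G. (\<Sum>x\<in>X. W y h x (fst i) * U y' k x (snd i)) * (\<lambda>(f, g). a3 f g) i r))"
      using left_inverse_sum[where I = "F \<times> G" and j = "(f, g)" and P = R and L = L and T = "\<lambda>(f, g). a3 f g"
        and x = "\<lambda>i. \<Sum>x\<in>X. W y h x (fst i) * U y' k x (snd i)"] that A.finite L by simp
    also have "\<dots> = (\<Sum>r\<in>R. L (f, g) r * (of_bool (y = y') * b3 h k r))"
      using b3[OF that(1-4)] by (simp add: case_prod_unfold)
    finally show ?thesis
      by (simp add: \<tau>_def sum_distrib_left mult_ac)
  qed
  have "\<exists>h\<in>F'. \<exists>k\<in>G'. \<exists>f\<in>F. \<exists>g\<in>G. \<tau> h k f g \<noteq> 0"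
  proof (rule ccontr)
    assume neg: "\<not> ?thesis"
    obtain y h k where yhk: "y \<in> Y" "h \<in> F'" "k \<in> G'" using B.nonempty by blast
    then obtain r where r: "r \<in> R" "b3 h k r \<noteq> 0"
      using left_invertible_on_nonzero[OF B.left_invertible(3), of "(h, k)"] by auto
    have "b3 h k r = (\<Sum>(f, g)\<in>F \<times> G. \<tau> h k f g * a3 f g r)"
      using b3[OF yhk(1,1,2,3) r(1)] \<tau>[OF yhk(1,1,2,3)] by (auto intro!: sum.cong)
    also have "\<dots> = 0" using neg yhk by (intro sum.neutral) auto
    finally show False using r by simp
  qed
  with W1 W2 \<tau> show thesis by (rule that)
qed

end

text \<open>If \<open>m < n\<close>, padding with zero columns and zero rows gives square matrices
  with \<open>M * N = 1\<close>. Then also \<open>N * M = 1\<close>, although row \<open>m\<close>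
  of \<open>N\<close> is zero.\<close>

lemma right_inverse_dim_le:
  fixes Z Zi :: "nat \<Rightarrow> nat \<Rightarrow> complex"
  assumes "\<And>y y'. y < n \<Longrightarrow> y' < n \<Longrightarrow> (\<Sum>x<m. Z y x * Zi x y') = of_bool (y = y')"
  shows "n \<le> m"
proof (rule ccontr)
  assume "\<not> n \<le> m"
  then have mn: "m < n" by simp
  define M where "M = mat n n (\<lambda>(y, x). if x < m then Z y x else 0)"
  define N where "N = mat n n (\<lambda>(x, y). if x < m then Zi x y else 0)"
  have "(\<Sum>x = 0..<n. (if x < m then Z y x else 0) * (if x < m then Zi x y' else 0))
      = (\<Sum>x<m. Z y x * Zi x y')" for y y'
    using mn by (intro sum.mono_neutral_cong_right) auto
  then have "M * N = 1\<^sub>m n"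
    unfolding M_def N_def by (intro eq_matI) (simp_all add: scalar_prod_def assms)
  then have "N * M = 1\<^sub>m n"
    by (intro mat_mult_left_right_inverse[of M n N]) (simp_all add: M_def N_def)
  then have "(N * M) $$ (m, m) = 1" using mn by simp
  then show False using mn by (simp add: M_def N_def scalar_prod_def)
qed

lemma right_inverse_imp_left_inverse:
  fixes Z Zi :: "nat \<Rightarrow> nat \<Rightarrow> complex"
  assumes "\<And>y y'. y < n \<Longrightarrow> y' < n \<Longrightarrow> (\<Sum>x<n. Z y x * Zi x y') = of_bool (y = y')"
    and "x < n" and "x' < n"
  shows "(\<Sum>y<n. Zi x y * Z y x') = of_bool (x = x')"
proof -
  define M where "M = mat n n (\<lambda>(y, x). Z y x)"
  define N where "N = mat n n (\<lambda>(x, y). Zi x y)"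
  have "M * N = 1\<^sub>m n"
    unfolding M_def N_def
    by (intro eq_matI) (simp_all add: scalar_prod_def assms lessThan_atLeast0[symmetric])
  then have "N * M = 1\<^sub>m n"
    by (intro mat_mult_left_right_inverse[of M n N]) (simp_all add: M_def N_def)
  then have "(N * M) $$ (x, x') = of_bool (x = x')" using assms(2,3) by simp
  then show ?thesis using assms(2,3)
    by (simp add: M_def N_def scalar_prod_def lessThan_atLeast0[symmetric])
qed

section \<open>The gauge on one bond of a ring\<close>

lemma injective_ring_pair_dim_le:
  fixes m n :: nat
  assumes "injective_ring_pair {..<m} F G {..<n} F' G' P Q R a1 a2 a3 b1 b2 b3"
  shows "n \<le> m"
proof -
  interpret injective_ring_pair "{..<m}" F G "{..<n}" F' G' P Q R a1 a2 a3 b1 b2 b3 by fact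
  obtain W U \<tau> where W: "\<And>y y' h k f g. y \<in> {..<n} \<Longrightarrow> y' \<in> {..<n} \<Longrightarrow> h \<in> F' \<Longrightarrow> k \<in> G' \<Longrightarrow> f \<in> F \<Longrightarrow> g \<in> G \<Longrightarrow>
      (\<Sum>x<m. W y h x f * U y' k x g) = of_bool (y = y') * \<tau> h k f g"
    and "\<exists>h\<in>F'. \<exists>k\<in>G'. \<exists>f\<in>F. \<exists>g\<in>G. \<tau> h k f g \<noteq> (0::complex)"
    by (rule cut_gauges) blast
  then obtain h k f g where h: "h \<in> F'" "k \<in> G'" "f \<in> F" "g \<in> G" "\<tau> h k f g \<noteq> 0" by blast
  show ?thesis
  proof (rule right_inverse_dim_le)
    fix y y' assume "y < n" "y' < n"
    then show "(\<Sum>x<m. W y h x f * (U y' k x g / \<tau> h k f g)) = of_bool (y = y')"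
      using W[OF _ _ h(1-4), of y y'] h(5) by (simp flip: sum_divide_distrib)
  qed
qed

lemma injective_ring_pair_sym:
  assumes "injective_ring_pair X F G Y F' G' P Q R a1 a2 a3 b1 b2 b3"
  shows "injective_ring_pair Y F' G' X F G P Q R b1 b2 b3 a1 a2 a3"
proof -
  interpret injective_ring_pair X F G Y F' G' P Q R a1 a2 a3 b1 b2 b3 by fact
  show ?thesis by unfold_locales (simp add: same_state)
qed

text \<open>All the blocks \<open>W y h x f\<close> (fixed \<open>h\<close>, \<open>f\<close>) have the same inverse up to scalars, so they are
  multiples \<open>c h f\<close> of one matrix \<open>Z\<close>: the gauge of the first cut acts on \<open>X\<close> by \<open>Z\<close> alone.\<close>

lemma injective_ring_pair_gauge:
  fixes m n :: nat
  assumes "injective_ring_pair {..<m} F G {..<n} F' G' P Q R a1 a2 a3 b1 b2 b3"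
  obtains Z Zi where "m = n"
    "\<And>y y'. y < n \<Longrightarrow> y' < n \<Longrightarrow> (\<Sum>x<m. Z y x * Zi x y') = of_bool (y = y')"
    "\<And>x x' p q r. x < m \<Longrightarrow> x' < m \<Longrightarrow> p \<in> P \<Longrightarrow> q \<in> Q \<Longrightarrow> r \<in> R \<Longrightarrow>
      injective_ring.cut_state F G a1 a2 a3 x x' p q r
      = (\<Sum>y<n. \<Sum>y'<n. Z y x * Zi x' y' * injective_ring.cut_state F' G' b1 b2 b3 y y' p q r)"
proof -
  interpret injective_ring_pair "{..<m}" F G "{..<n}" F' G' P Q R a1 a2 a3 b1 b2 b3 by fact
  have mn: "m = n"
    using injective_ring_pair_dim_le[OF assms]
      injective_ring_pair_dim_le[OF injective_ring_pair_sym[OF assms]] by simp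
  obtain W U \<tau> where
    W1: "\<And>x f p. x \<in> {..<m} \<Longrightarrow> f \<in> F \<Longrightarrow> p \<in> P \<Longrightarrow> a1 x f p = (\<Sum>y<n. \<Sum>h\<in>F'. W y h x f * b1 y h p)"
    and W2: "\<And>y h q r. y \<in> {..<n} \<Longrightarrow> h \<in> F' \<Longrightarrow> q \<in> Q \<Longrightarrow> r \<in> R \<Longrightarrow>
      B.rest1 y h q r = (\<Sum>x<m. \<Sum>f\<in>F. W y h x f * A.rest1 x f q r)"
    and WU: "\<And>y y' h k f g. y \<in> {..<n} \<Longrightarrow> y' \<in> {..<n} \<Longrightarrow> h \<in> F' \<Longrightarrow> k \<in> G' \<Longrightarrow> f \<in> F \<Longrightarrow> g \<in> G \<Longrightarrow>
      (\<Sum>x<m. W y h x f * U y' k x g) = of_bool (y = y') * \<tau> h k f g"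
    and ex: "\<exists>h\<in>F'. \<exists>k\<in>G'. \<exists>f\<in>F. \<exists>g\<in>G. \<tau> h k f g \<noteq> (0::complex)"
    by (rule cut_gauges) blast
  obtain h0 k0 f0 g0 where 0: "h0 \<in> F'" "k0 \<in> G'" "f0 \<in> F" "g0 \<in> G" "\<tau> h0 k0 f0 g0 \<noteq> 0"
    using ex by blast
  \<comment> \<open>The base indices only locate a nonzero \<open>\<tau>\<close>. After division by
    it, the single matrix \<open>U\<close> at \<open>(k0, g0)\<close> is a common inverse, up to the
    scalars \<open>c h f\<close>, of all blocks of \<open>W\<close>, and
    \<open>c h0 f0 = 1\<close>.\<close>
  define Z where "Z y x = W y h0 x f0" for y x
  define Zi where "Zi x y = U y k0 x g0 / \<tau> h0 k0 f0 g0" for x y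
  define c where "c h f = \<tau> h k0 f g0 / \<tau> h0 k0 f0 g0" for h f
  have W_Zi: "(\<Sum>x<m. W y h x f * Zi x y') = of_bool (y = y') * c h f"
    if "y < n" "y' < n" "h \<in> F'" "f \<in> F" for y y' h f
    using WU[of y y' h k0 f g0] that 0 by (simp add: Zi_def c_def flip: sum_divide_distrib)
  have Z_Zi: "(\<Sum>x<m. Z y x * Zi x y') = of_bool (y = y')" if "y < n" "y' < n" for y y'
    using W_Zi[OF that 0(1,3)] 0 by (simp add: Z_def c_def)
  have Zi_Z: "(\<Sum>y<n. Zi x y * Z y x') = of_bool (x = x')" if "x < m" "x' < m" for x x'
    using right_inverse_imp_left_inverse[of n Z Zi x x'] Z_Zi that mn by simp
  have W_Z: "W y h x f = c h f * Z y x" if "y < n" "x < m" "h \<in> F'" "f \<in> F" for y h x f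
  proof -
    have "W y h x f = (\<Sum>x'<m. W y h x' f * of_bool (x' = x))"
      using that by (simp add: sum_mult_delta)
    also have "\<dots> = (\<Sum>x'<m. W y h x' f * (\<Sum>y'<n. Zi x' y' * Z y' x))"
      using Zi_Z that by simp
    also have "\<dots> = (\<Sum>y'<n. (\<Sum>x'<m. W y h x' f * Zi x' y') * Z y' x)"
      unfolding sum_distrib_left sum_distrib_right by (subst sum.swap) (simp add: mult_ac)
    also have "\<dots> = (\<Sum>y'<n. of_bool (y = y') * (c h f * Z y' x))"
      using W_Zi that by (simp add: mult_ac)
    finally show ?thesis using that by (simp add: sum_mult_delta)
  qed
  \<comment> \<open>The relation between the complements is inverted on the bond \<open>X\<close>
    alone. The matrix \<open>c\<close> on the remaining bond stays, and absorbs the equal factor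
    that \<open>W\<close> contributes to the first tensor.\<close>
  have rest: "(\<Sum>f\<in>F. c h f * A.rest1 x f q r) = (\<Sum>y<n. Zi x y * B.rest1 y h q r)"
    if "x < m" "h \<in> F'" "q \<in> Q" "r \<in> R" for x h q r
  proof -
    have "(\<Sum>y<n. Zi x y * B.rest1 y h q r)
        = (\<Sum>y<n. Zi x y * (\<Sum>x'<m. Z y x' * (\<Sum>f\<in>F. c h f * A.rest1 x' f q r)))"
      using W2[of _ h q r] that by (intro sum.cong refl) (simp add: W_Z sum_distrib_left mult_ac)
    also have "\<dots> = (\<Sum>x'<m. (\<Sum>y<n. Zi x y * Z y x') * (\<Sum>f\<in>F. c h f * A.rest1 x' f q r))"
      unfolding sum_distrib_left[of "Zi _ _"] sum_distrib_right by (subst sum.swap) (simp add: mult_ac)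
    also have "\<dots> = (\<Sum>x'<m. of_bool (x = x') * (\<Sum>f\<in>F. c h f * A.rest1 x' f q r))"
      using Zi_Z that by simp
    finally show ?thesis using that by (simp add: sum_mult_delta)
  qed
  have "A.cut_state x x' p q r = (\<Sum>y<n. \<Sum>y'<n. Z y x * Zi x' y' * B.cut_state y y' p q r)"
    if "x < m" "x' < m" "p \<in> P" "q \<in> Q" "r \<in> R" for x x' p q r
  proof -
    have "A.cut_state x x' p q r
        = (\<Sum>f\<in>F. \<Sum>i\<in>{..<n} \<times> F'. Z (fst i) x * b1 (fst i) (snd i) p * (c (snd i) f * A.rest1 x' f q r))"
      unfolding A.cut_state_def using W1[OF _ _ that(3), of x] that
      by (intro sum.cong refl)
        (auto simp: W_Z sum.cartesian_product sum_distrib_left sum_distrib_right case_prod_unfold mult_ac intro!: sum.cong)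
    also have "\<dots> = (\<Sum>i\<in>{..<n} \<times> F'. Z (fst i) x * b1 (fst i) (snd i) p * (\<Sum>f\<in>F. c (snd i) f * A.rest1 x' f q r))"
      unfolding sum_distrib_left by (rule sum.swap)
    also have "\<dots> = (\<Sum>y<n. \<Sum>h\<in>F'. Z y x * b1 y h p * (\<Sum>y'<n. Zi x' y' * B.rest1 y' h q r))"
      using rest[OF that(2) _ that(4,5)]
      by (auto simp: sum.cartesian_product case_prod_unfold intro!: sum.cong)
    also have "\<dots> = (\<Sum>y<n. \<Sum>y'<n. Z y x * Zi x' y' * B.cut_state y y' p q r)"
      unfolding B.cut_state_def sum_distrib_left
      by (intro sum.cong refl, subst sum.swap) (simp add: mult_ac)
    finally show ?thesis .
  qed
  with mn Z_Zi show thesis by (rule that)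
qed

section \<open>Cuts through several bonds\<close>

lemma sum_PiE_remove:
  assumes "e \<in> K"
  shows "(\<Sum>i\<in>PiE K S. h i) = (\<Sum>x\<in>S e. \<Sum>k\<in>PiE (K - {e}) S. h (k(e := x)))"
proof -
  have "PiE K S = (\<lambda>(x, k). k(e := x)) ` (S e \<times> PiE (K - {e}) S)"
    using PiE_insert_eq[of e "K - {e}" S] assms by (simp add: insert_absorb)
  moreover have "inj_on (\<lambda>(x, k). k(e := x)) (S e \<times> PiE (K - {e}) S)"
    using inj_combinator[of e "K - {e}" S] by simp
  ultimately show ?thesis
    by (simp add: sum.reindex sum.cartesian_product case_prod_unfold)
qed

lemma sum_PiE_Un:
  assumes "A \<inter> B = {}"
  shows "(\<Sum>i\<in>PiE (A \<union> B) S. h i) = (\<Sum>k\<in>PiE A S. \<Sum>l\<in>PiE B S. h (override_on l k A))"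
proof -
  have "(\<Sum>i\<in>PiE (A \<union> B) S. h i) = (\<Sum>(k, l)\<in>PiE A S \<times> PiE B S. h (override_on l k A))"
  proof (rule sum.reindex_bij_witness[where i = "\<lambda>(k, l). override_on l k A"
        and j = "\<lambda>i. (restrict i A, restrict i B)"])
    fix i assume i: "i \<in> PiE (A \<union> B) S"
    show eq: "(case (restrict i A, restrict i B) of (k, l) \<Rightarrow> override_on l k A) = i"
      using i by (auto simp: override_on_def fun_eq_iff PiE_iff extensional_def)
    show "(restrict i A, restrict i B) \<in> PiE A S \<times> PiE B S"
      using i by (auto simp: PiE_iff)
    show "(case (restrict i A, restrict i B) of (k, l) \<Rightarrow> h (override_on l k A)) = h i"
      using eq by simp
  next
    fix c assume "c \<in> PiE A S \<times> PiE B S"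
    then obtain k l where c: "c = (k, l)" "k \<in> PiE A S" "l \<in> PiE B S" by auto
    show "(restrict (case c of (k, l) \<Rightarrow> override_on l k A) A,
        restrict (case c of (k, l) \<Rightarrow> override_on l k A) B) = c"
      using c assms by (auto simp: override_on_def fun_eq_iff PiE_iff extensional_def)
    show "(case c of (k, l) \<Rightarrow> override_on l k A) \<in> PiE (A \<union> B) S"
      using c assms by (auto simp: override_on_def PiE_iff extensional_def)
  qed
  then show ?thesis by (simp add: sum.cartesian_product)
qed

text \<open>The coordinates are moved one at a time from \<open>(j, i)\<close> to the base point
  \<open>(j0, i0)\<close>. Moving coordinate \<open>e\<close> leaves \<open>N\<close> unchanged and
  so costs only a ratio of entries of \<open>Z e\<close>; the entries at the base point are nonzero,
  so the ratios make sense.\<close>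

lemma product_form:
  fixes W :: "('e \<Rightarrow> nat) \<Rightarrow> ('e \<Rightarrow> nat) \<Rightarrow> complex"
  assumes "finite K" and i0: "i0 \<in> PiE K S" and j0: "j0 \<in> PiE K T"
    and nz: "\<And>e. e \<in> K \<Longrightarrow> Z e (j0 e) (i0 e) \<noteq> 0"
    and fact: "\<And>e. e \<in> K \<Longrightarrow> \<exists>N. \<forall>j\<in>PiE K T. \<forall>i\<in>PiE K S.
      W j i = Z e (j e) (i e) * N j i \<and> (\<forall>x y. N (j(e := y)) (i(e := x)) = N j i)"
  obtains c where "\<And>i j. i \<in> PiE K S \<Longrightarrow> j \<in> PiE K T \<Longrightarrow> W j i = c * (\<Prod>e\<in>K. Z e (j e) (i e))"
proof -
  have ext: "override_on j j0 K' \<in> PiE K T \<and> override_on i i0 K' \<in> PiE K S"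
    if "i \<in> PiE K S" "j \<in> PiE K T" "K' \<subseteq> K" for i j K'
    using that i0 j0 by (auto simp: override_on_def PiE_iff extensional_def)
  have partial: "W j i = (\<Prod>e\<in>K'. Z e (j e) (i e) / Z e (j0 e) (i0 e))
      * W (override_on j j0 K') (override_on i i0 K')"
    if "finite K'" "K' \<subseteq> K" "i \<in> PiE K S" "j \<in> PiE K T" for i j K'
    using that(1,2)
  proof (induction K')
    case empty
    show ?case by simp
  next
    case (insert e K')
    define j' i' where "j' = override_on j j0 K'" and "i' = override_on i i0 K'"
    have e: "e \<in> K" using insert.prems by simp
    obtain N where N: "\<And>i j. i \<in> PiE K S \<Longrightarrow> j \<in> PiE K T \<Longrightarrow> W j i = Z e (j e) (i e) * N j i"
      "\<And>i j x y. i \<in> PiE K S \<Longrightarrow> j \<in> PiE K T \<Longrightarrow> N (j(e := y)) (i(e := x)) = N j i"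
      using fact[OF e] by blast
    have upd: "override_on j j0 (insert e K') = j'(e := j0 e)"
      "override_on i i0 (insert e K') = i'(e := i0 e)"
      by (auto simp: j'_def i'_def override_on_def)
    have mem: "j' \<in> PiE K T" "i' \<in> PiE K S"
      using ext[OF that(3,4), of K'] insert.prems by (auto simp: j'_def i'_def)
    have mem': "j'(e := j0 e) \<in> PiE K T" "i'(e := i0 e) \<in> PiE K S"
      using ext[OF that(3,4), of "insert e K'"] insert.prems by (auto simp: upd)
    have at_e: "j' e = j e" "i' e = i e"
      using insert.hyps by (auto simp: j'_def i'_def)
    have "W j' i' = Z e (j e) (i e) / Z e (j0 e) (i0 e) * W (j'(e := j0 e)) (i'(e := i0 e))"
      using N(1)[OF mem(2,1)] N(1)[OF mem'(2,1)] N(2)[OF mem(2,1)] nz[OF e] at_e by simp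
    moreover have "W j i = (\<Prod>e\<in>K'. Z e (j e) (i e) / Z e (j0 e) (i0 e)) * W j' i'"
      using insert.IH insert.prems by (simp add: j'_def i'_def)
    ultimately show ?case
      using insert.hyps unfolding upd by (simp add: mult_ac fun_upd_def)
  qed
  show thesis
  proof (rule that)
    fix i j assume ij: "i \<in> PiE K S" "j \<in> PiE K T"
    have "override_on j j0 K = j0" "override_on i i0 K = i0"
      using ij i0 j0 by (auto simp: override_on_def fun_eq_iff PiE_iff extensional_def)
    with partial[OF assms(1) order.refl ij]
    show "W j i = W j0 i0 / (\<Prod>e\<in>K. Z e (j0 e) (i0 e)) * (\<Prod>e\<in>K. Z e (j e) (i e))"
      by (simp add: prod_dividef)
  qed
qed

text \<open>Across a cut with bonds \<open>K\<close> the gauge \<open>W\<close> of the whole cut intertwines, for every single bond,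
  the operators inserted on that bond, hence it is proportional to the product of the bond gauges.\<close>

lemma cut_gauge_product:
  fixes a b :: "('e \<Rightarrow> nat) \<Rightarrow> 'p \<Rightarrow> complex" and a' b' :: "('e \<Rightarrow> nat) \<Rightarrow> 'q \<Rightarrow> complex"
    and m n :: "'e \<Rightarrow> nat" and Z Zi :: "'e \<Rightarrow> nat \<Rightarrow> nat \<Rightarrow> complex"
  defines "I \<equiv> \<lambda>K. PiE K (\<lambda>e. {..<m e})" and "J \<equiv> \<lambda>K. PiE K (\<lambda>e. {..<n e})"
  assumes fin: "finite K" and pos: "\<And>e. e \<in> K \<Longrightarrow> m e > 0" "\<And>e. e \<in> K \<Longrightarrow> n e > 0"
    and inj: "left_invertible_on (J K) P b" "left_invertible_on (I K) Q a'" "left_invertible_on (I K) P a"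
    and state: "\<And>p q. p \<in> P \<Longrightarrow> q \<in> Q \<Longrightarrow> (\<Sum>i\<in>I K. a i p * a' i q) = (\<Sum>j\<in>J K. b j p * b' j q)"
    and Z_Zi: "\<And>e y y'. e \<in> K \<Longrightarrow> y < n e \<Longrightarrow> y' < n e \<Longrightarrow>
      (\<Sum>x<m e. Z e y x * Zi e x y') = of_bool (y = y')"
    and split: "\<And>e x x' p q. e \<in> K \<Longrightarrow> x < m e \<Longrightarrow> x' < m e \<Longrightarrow> p \<in> P \<Longrightarrow> q \<in> Q \<Longrightarrow>
      (\<Sum>k\<in>I (K - {e}). a (k(e := x)) p * a' (k(e := x')) q)
      = (\<Sum>y<n e. \<Sum>y'<n e. Z e y x * Zi e x' y' *
          (\<Sum>k\<in>J (K - {e}). b (k(e := y)) p * b' (k(e := y')) q))"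
  obtains c where "c \<noteq> 0"
    and "\<And>i p. i \<in> I K \<Longrightarrow> p \<in> P \<Longrightarrow> a i p = c * (\<Sum>j\<in>J K. (\<Prod>e\<in>K. Z e (j e) (i e)) * b j p)"
proof -
  have finIJ: "finite (I K)" "finite (J K)"
    unfolding I_def J_def using fin by (auto intro!: finite_PiE)
  obtain W where W: "\<And>i p. i \<in> I K \<Longrightarrow> p \<in> P \<Longrightarrow> a i p = (\<Sum>j\<in>J K. W j i * b j p)"
    and W': "\<And>j q. j \<in> J K \<Longrightarrow> q \<in> Q \<Longrightarrow> b' j q = (\<Sum>i\<in>I K. W j i * a' i q)"
    using bipartite_gauge[OF finIJ inj(1,2) state] by blast
  have upd_I: "k(e := x) \<in> I K" if "k \<in> I (K - {e})" "e \<in> K" "x < m e" for k e x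
    using that unfolding I_def by (auto simp: PiE_iff extensional_def)
  have upd_J: "k(e := x) \<in> J K" if "k \<in> J K" "e \<in> K" "x < n e" for k e x
    using that unfolding J_def by (auto simp: PiE_iff extensional_def)
  have upd_I': "k(e := x) \<in> I K" if "k \<in> I K" "e \<in> K" "x < m e" for k e x
    using that unfolding I_def by (auto simp: PiE_iff extensional_def)
  \<comment> \<open>Insert the expansion of \<open>a\<close> into \<open>split\<close> and cancel
    the independent \<open>b\<close>.\<close>
  have W_a': "(\<Sum>k\<in>I (K - {e}). W j (k(e := x)) * a' (k(e := x')) q)
      = Z e (j e) x * (\<Sum>y'<n e. Zi e x' y' * b' (j(e := y')) q)"
    if e: "e \<in> K" "x < m e" "x' < m e" and j: "j \<in> J K" and q: "q \<in> Q" for e x x' j q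
  proof (rule left_invertible_on_cancel[OF inj(1) finIJ(2) j])
    fix p assume p: "p \<in> P"
    have "(\<Sum>j\<in>J K. (\<Sum>k\<in>I (K - {e}). W j (k(e := x)) * a' (k(e := x')) q) * b j p)
        = (\<Sum>k\<in>I (K - {e}). (\<Sum>j\<in>J K. W j (k(e := x)) * b j p) * a' (k(e := x')) q)"
      unfolding sum_distrib_right by (subst sum.swap) (simp add: mult_ac)
    also have "\<dots> = (\<Sum>k\<in>I (K - {e}). a (k(e := x)) p * a' (k(e := x')) q)"
      using W upd_I e p by simp
    also have "\<dots> = (\<Sum>y<n e. \<Sum>k\<in>J (K - {e}).
        (Z e y x * (\<Sum>y'<n e. Zi e x' y' * b' (k(e := y')) q)) * b (k(e := y)) p)"
      unfolding split[OF e p q] sum_distrib_left sum_distrib_right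
      by (intro sum.cong refl, subst sum.swap) (simp add: mult_ac)
    also have "\<dots> = (\<Sum>j\<in>J K. (Z e (j e) x * (\<Sum>y'<n e. Zi e x' y' * b' (j(e := y')) q)) * b j p)"
      unfolding J_def by (subst sum_PiE_remove[OF e(1)]) simp
    finally show "(\<Sum>j\<in>J K. (\<Sum>k\<in>I (K - {e}). W j (k(e := x)) * a' (k(e := x')) q) * b j p)
        = (\<Sum>j\<in>J K. (Z e (j e) x * (\<Sum>y'<n e. Zi e x' y' * b' (j(e := y')) q)) * b j p)" .
  qed
  \<comment> \<open>Cancelling \<open>a'\<close> as well leaves a relation between entries of
    \<open>W\<close>. The indicator arises because the left side of \<open>W_a'\<close> contains
    \<open>a'\<close> only at indices with the value \<open>x'\<close> on \<open>e\<close>.\<close>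
  have W_eq: "W j (i(e := x)) * of_bool (i e = x') = Z e (j e) x * (\<Sum>y'<n e. Zi e x' y' * W (j(e := y')) i)"
    if e: "e \<in> K" "x < m e" "x' < m e" and ji: "j \<in> J K" "i \<in> I K" for e x x' j i
  proof (rule left_invertible_on_cancel[OF inj(2) finIJ(1) ji(2)])
    fix q assume q: "q \<in> Q"
    have "(\<Sum>i\<in>I K. W j (i(e := x)) * of_bool (i e = x') * a' i q)
        = (\<Sum>k\<in>I (K - {e}). \<Sum>z<m e. W j (k(e := x)) * a' (k(e := z)) q * of_bool (z = x'))"
      unfolding I_def by (subst sum_PiE_remove[OF e(1)], subst sum.swap) (simp add: mult_ac)
    also have "\<dots> = (\<Sum>k\<in>I (K - {e}). W j (k(e := x)) * a' (k(e := x')) q)"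
      using e by (simp add: sum_mult_delta)
    also have "\<dots> = Z e (j e) x * (\<Sum>y'<n e. Zi e x' y' * (\<Sum>i\<in>I K. W (j(e := y')) i * a' i q))"
      unfolding W_a'[OF e ji(1) q] using W' upd_J[OF ji(1) e(1)] q by simp
    also have "\<dots> = (\<Sum>i\<in>I K. (Z e (j e) x * (\<Sum>y'<n e. Zi e x' y' * W (j(e := y')) i)) * a' i q)"
      unfolding sum_distrib_left sum_distrib_right by (subst sum.swap) (simp add: mult_ac)
    finally show "(\<Sum>i\<in>I K. W j (i(e := x)) * of_bool (i e = x') * a' i q)
        = (\<Sum>i\<in>I K. (Z e (j e) x * (\<Sum>y'<n e. Zi e x' y' * W (j(e := y')) i)) * a' i q)" .
  qed
  have "\<exists>x y. x < m e \<and> y < n e \<and> Z e y x \<noteq> 0" if "e \<in> K" for e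
  proof (rule ccontr)
    assume "\<not> ?thesis"
    then have "(\<Sum>x<m e. Z e 0 x * Zi e x 0) = 0" using pos that by (intro sum.neutral) auto
    with Z_Zi[OF that, of 0 0] pos that show False by simp
  qed
  then obtain x0 y0 where 0: "\<And>e. e \<in> K \<Longrightarrow> x0 e < m e \<and> y0 e < n e \<and> Z e (y0 e) (x0 e) \<noteq> 0"
    by metis
  have i0: "restrict x0 K \<in> PiE K (\<lambda>e. {..<m e})" and j0: "restrict y0 K \<in> PiE K (\<lambda>e. {..<n e})"
    using 0 by auto
  obtain c where c: "\<And>i j. i \<in> I K \<Longrightarrow> j \<in> J K \<Longrightarrow> W j i = c * (\<Prod>e\<in>K. Z e (j e) (i e))"
  proof (rule product_form[OF fin i0 j0, where Z = Z and W = W])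
    fix e assume e: "e \<in> K"
    show "Z e (restrict y0 K e) (restrict x0 K e) \<noteq> 0" using 0 e by simp
    \<comment> \<open>Apply \<open>W_eq\<close> to \<open>i(e := x0 e)\<close> with
      \<open>x = i e\<close> and \<open>x' = x0 e\<close>, so that the indicator is 1. The remaining
      factor has its row index on \<open>e\<close> summed out and its column index on
      \<open>e\<close> fixed; hence it does not see these coordinates.\<close>
    define N where "N j i = (\<Sum>y'<n e. Zi e (x0 e) y' * W (j(e := y')) (i(e := x0 e)))" for j i
    have "W j i = Z e (j e) (i e) * N j i" if "j \<in> J K" "i \<in> I K" for i j
    proof -
      have "i e < m e" using that e by (auto simp: I_def PiE_iff)
      then show ?thesis
        using W_eq[OF e _ _ that(1) upd_I'[OF that(2) e], of "i e" "x0 e" "x0 e"] 0[OF e]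
        by (simp add: N_def)
    qed
    moreover have "N (j(e := y)) (i(e := x)) = N j i" for j i x y
      by (simp add: N_def)
    ultimately show "\<exists>N. \<forall>j\<in>\<Pi>\<^sub>E e\<in>K. {..<n e}. \<forall>i\<in>\<Pi>\<^sub>E e\<in>K. {..<m e}.
        W j i = Z e (j e) (i e) * N j i \<and> (\<forall>x y. N (j(e := y)) (i(e := x)) = N j i)"
      unfolding I_def J_def by blast
  qed (auto simp: I_def J_def)
  have a: "a i p = c * (\<Sum>j\<in>J K. (\<Prod>e\<in>K. Z e (j e) (i e)) * b j p)" if "i \<in> I K" "p \<in> P" for i p
    using W[OF that] c that by (simp add: sum_distrib_left mult_ac)
  \<comment> \<open>With \<open>c = 0\<close> the family \<open>a\<close> would vanish on this
    index, against its independence.\<close>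
  have "restrict x0 K \<in> I K" using i0 by (simp add: I_def)
  then obtain p where "p \<in> P" "a (restrict x0 K) p \<noteq> 0"
    using left_invertible_on_nonzero[OF inj(3)] by blast
  then have "c \<noteq> 0" using a[OF \<open>restrict x0 K \<in> I K\<close>] by auto
  then show thesis using a by (rule that)
qed

section \<open>Blocking\<close>

lemma simple_graph_finite_edges:
  assumes "simple_graph V E"
  shows "finite E"
proof -
  have "E \<subseteq> Pow V" "finite (Pow V)" using assms by (auto simp: simple_graph_def)
  then show ?thesis by (rule finite_subset)
qed

lemma simple_graph_edgeE:
  assumes "simple_graph V E" and "e \<in> E"
  obtains u v where "e = {u, v}" "u \<noteq> v" "u \<in> V" "v \<in> V"
  using assms unfolding simple_graph_def by (auto simp: card_2_iff)

lemma simple_graph_edge_cases: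
  assumes "simple_graph V E" and "e \<in> E" and "s \<in> e" and "t \<in> e" and "s \<noteq> t"
  shows "e = {s, t}"
  using simple_graph_edgeE[OF assms(1,2)] assms(3-5) by (metis doubleton_eq_iff insertE singletonD)

lemma leaving_edges_ends:
  assumes "simple_graph V E" and "e \<in> leaving_edges E R"
  obtains u v where "e = {u, v}" "u \<in> R" "v \<notin> R" "e \<inter> R = {u}" "e - R = {v}"
proof -
  have "e \<in> E" using assms(2) by (simp add: leaving_edges_def)
  then obtain a b where ab: "e = {a, b}" "a \<noteq> b" using simple_graph_edgeE[OF assms(1)] by metis
  show thesis
  proof (cases "a \<in> R")
    case True
    then show thesis using ab assms(2) by (intro that[of a b]) (auto simp: leaving_edges_def)
  next
    case False
    then show thesis using ab assms(2) by (intro that[of b a]) (auto simp: leaving_edges_def)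
  qed
qed

section \<open>Index sets and contraction of blocks\<close>

lemma finite_bond_indices [simp]: "finite F \<Longrightarrow> finite (bond_indices P F)"
  unfolding bond_indices_def by (auto intro!: finite_PiE)

lemma bond_indices_nonempty:
  assumes "is_peps E P" and "F \<subseteq> E"
  shows "bond_indices P F \<noteq> {}"
  using assms unfolding bond_indices_def is_peps_def by (auto simp: PiE_eq_empty_iff)

lemma finite_phys_indices [simp]: "finite R \<Longrightarrow> finite (phys_indices d R)"
  unfolding phys_indices_def by (auto intro!: finite_PiE)

lemma phys_indices_override:
  assumes p: "p \<in> phys_indices d R" and q: "q \<in> phys_indices d (V - R)" and R: "R \<subseteq> V"
  shows "override_on q p R \<in> phys_indices d V"
  unfolding phys_indices_def
proof (rule PiE_I)
  fix s assume "s \<in> V"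
  then show "override_on q p R s \<in> {..<d s}"
    using PiE_mem[OF p[unfolded phys_indices_def], of s] PiE_mem[OF q[unfolded phys_indices_def], of s]
    by (simp add: override_on_def)
next
  fix s assume "s \<notin> V"
  then show "override_on q p R s = undefined"
    using PiE_arb[OF q[unfolded phys_indices_def], of s] R by (auto simp: override_on_def)
qed

lemma blocked_tensor_cong:
  assumes "\<And>e. e \<in> leaving_edges E R \<Longrightarrow> i e = j e" and "\<And>s. s \<in> R \<Longrightarrow> p s = q s"
  shows "blocked_tensor E P R i p = blocked_tensor E P R j q"
  unfolding blocked_tensor_def
proof (intro sum.cong prod.cong refl)
  fix k s assume s: "s \<in> R"
  have "restrict (\<lambda>e. if e \<subseteq> R then k e else i e) (edges_at E s)
      = restrict (\<lambda>e. if e \<subseteq> R then k e else j e) (edges_at E s)"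
    using s assms(1) by (intro restrict_ext) (auto simp: edges_at_def leaving_edges_def)
  then show "site_tensor P s (restrict (\<lambda>e. if e \<subseteq> R then k e else i e) (edges_at E s)) (p s)
      = site_tensor P s (restrict (\<lambda>e. if e \<subseteq> R then k e else j e) (edges_at E s)) (q s)"
    using assms(2)[OF s] by simp
qed

text \<open>Edges inside the union lie inside \<open>R\<close>, inside \<open>S\<close>, or between
  them. With the indices of the last kind fixed, the two remaining sums have no index in common and
  factorise.\<close>

lemma blocked_tensor_Un:
  assumes graph: "simple_graph V E" and "R \<union> S \<subseteq> V" and disj: "R \<inter> S = {}"
  shows "blocked_tensor E P (R \<union> S) i p =
    (\<Sum>k\<in>bond_indices P (edges_between E R S).
      blocked_tensor E P R (override_on i k (edges_between E R S)) p *
      blocked_tensor E P S (override_on i k (edges_between E R S)) p)"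
proof -
  let ?K = "edges_between E R S"
  let ?A = "inner_edges E R" and ?B = "inner_edges E S"
  have fin: "finite R" "finite S"
    using graph assms(2) by (auto simp: simple_graph_def intro: finite_subset)
  have K: "e \<subseteq> R \<union> S \<and> \<not> e \<subseteq> R \<and> \<not> e \<subseteq> S" if "e \<in> ?K" for e
    using that simple_graph_edgeE[OF graph, of e] disj by (auto simp: edges_between_def)
  have K': "e \<in> ?K" if "e \<in> E" "e \<subseteq> R \<union> S" "\<not> e \<subseteq> R" "\<not> e \<subseteq> S" for e
    using that by (auto simp: edges_between_def)
  have ne: "\<not> e \<subseteq> S" if "e \<in> E" "e \<subseteq> R" for e
    using simple_graph_edgeE[OF graph that(1)] that disj by (metis IntI empty_iff insert_subset)
  have inner: "inner_edges E (R \<union> S) = ?K \<union> (?A \<union> ?B)"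
    using K K' by (auto simp: inner_edges_def edges_between_def)
  have d1: "?K \<inter> (?A \<union> ?B) = {}" using K by (auto simp: inner_edges_def)
  have d2: "?A \<inter> ?B = {}" using ne by (auto simp: inner_edges_def)
  let ?m = "\<lambda>k a b e. if e \<subseteq> R \<union> S then override_on (override_on b a ?A) k ?K e else i e"
  have R: "restrict (?m k a b) (edges_at E s)
      = restrict (\<lambda>e. if e \<subseteq> R then a e else override_on i k ?K e) (edges_at E s)"
    if "s \<in> R" for s k a b
  proof (intro restrict_ext)
    fix e assume e: "e \<in> edges_at E s"
    then show "?m k a b e = (if e \<subseteq> R then a e else override_on i k ?K e)"
      using that K[of e] K'[of e] disj by (auto simp: edges_at_def override_on_def inner_edges_def)
  qed
  have S: "restrict (?m k a b) (edges_at E s)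
      = restrict (\<lambda>e. if e \<subseteq> S then b e else override_on i k ?K e) (edges_at E s)"
    if "s \<in> S" for s k a b
  proof (intro restrict_ext)
    fix e assume e: "e \<in> edges_at E s"
    then show "?m k a b e = (if e \<subseteq> S then b e else override_on i k ?K e)"
      using that K[of e] K'[of e] disj by (auto simp: edges_at_def override_on_def inner_edges_def)
  qed
  have "blocked_tensor E P (R \<union> S) i p
      = (\<Sum>k\<in>bond_indices P ?K. \<Sum>a\<in>bond_indices P ?A. \<Sum>b\<in>bond_indices P ?B.
          \<Prod>s\<in>R \<union> S. site_tensor P s (restrict (?m k a b) (edges_at E s)) (p s))"
    unfolding blocked_tensor_def bond_indices_def inner sum_PiE_Un[OF d1] sum_PiE_Un[OF d2] ..
  also have "\<dots> = (\<Sum>k\<in>bond_indices P ?K. \<Sum>a\<in>bond_indices P ?A. \<Sum>b\<in>bond_indices P ?B.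
      (\<Prod>s\<in>R. site_tensor P s (restrict (\<lambda>e. if e \<subseteq> R then a e else override_on i k ?K e) (edges_at E s)) (p s)) *
      (\<Prod>s\<in>S. site_tensor P s (restrict (\<lambda>e. if e \<subseteq> S then b e else override_on i k ?K e) (edges_at E s)) (p s)))"
    unfolding prod.union_disjoint[OF fin disj] by (simp add: R S cong: prod.cong)
  finally show ?thesis
    unfolding blocked_tensor_def by (simp add: sum_product)
qed

lemma peps_state_eq_blocked_tensor:
  assumes "simple_graph V E"
  shows "peps_state V E P p = blocked_tensor E P V i p"
proof -
  have sub: "e \<subseteq> V" if "e \<in> E" for e using assms that by (auto simp: simple_graph_def)
  then have "inner_edges E V = E" by (auto simp: inner_edges_def)
  moreover have "restrict (\<lambda>e. if e \<subseteq> V then k e else i e) (edges_at E s) = restrict k (edges_at E s)" for k s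
    using sub by (intro restrict_ext) (auto simp: edges_at_def)
  ultimately show ?thesis
    unfolding blocked_tensor_def peps_state_def by simp
qed

lemma leaving_edges_complement:
  assumes "simple_graph V E" and "R \<subseteq> V"
  shows "leaving_edges E (V - R) = leaving_edges E R"
    and "edges_between E R (V - R) = leaving_edges E R"
proof -
  have sub: "e \<subseteq> V" if "e \<in> E" for e using assms that by (auto simp: simple_graph_def)
  show "leaving_edges E (V - R) = leaving_edges E R"
    and "edges_between E R (V - R) = leaving_edges E R"
    using sub by (fastforce simp: leaving_edges_def edges_between_def)+
qed

lemma peps_state_cut:
  assumes "simple_graph V E" and "R \<subseteq> V"
  shows "peps_state V E P p =
    (\<Sum>i\<in>bond_indices P (leaving_edges E R). blocked_tensor E P R i p * blocked_tensor E P (V - R) i p)"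
proof -
  have V: "V = R \<union> (V - R)" using assms by auto
  \<comment> \<open>No edge leaves \<open>V\<close>, so the outer index 0 is arbitrary: on the bonds
    of the cut it is overwritten, and the two blocks read no other open index.\<close>
  have "blocked_tensor E P V (\<lambda>_. 0) p = blocked_tensor E P (R \<union> (V - R)) (\<lambda>_. 0) p"
    using V by simp
  also have "\<dots> = (\<Sum>i\<in>bond_indices P (leaving_edges E R).
      blocked_tensor E P R (override_on (\<lambda>_. 0) i (leaving_edges E R)) p
      * blocked_tensor E P (V - R) (override_on (\<lambda>_. 0) i (leaving_edges E R)) p)"
    using assms
    by (subst blocked_tensor_Un[OF assms(1)]) (auto simp: leaving_edges_complement)
  also have "\<dots> = (\<Sum>i\<in>bond_indices P (leaving_edges E R).
      blocked_tensor E P R i p * blocked_tensor E P (V - R) i p)"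
    using assms
    by (intro sum.cong refl arg_cong2[where f = "(*)"] blocked_tensor_cong)
      (auto simp: leaving_edges_complement)
  finally show ?thesis
    using peps_state_eq_blocked_tensor[OF assms(1)] by simp
qed

text \<open>Meant for the edge set \<open>E - {e}\<close>: the index of the removed edge \<open>e\<close> is frozen to \<open>c s\<close> at its end
  \<open>s\<close>, independently at both ends.\<close>

definition cut_peps :: "'v set \<Rightarrow> ('v \<Rightarrow> nat) \<Rightarrow> 'v peps \<Rightarrow> 'v peps" where
  "cut_peps e c P = P\<lparr>site_tensor := \<lambda>s i. site_tensor P s (if s \<in> e then i(e := c s) else i)\<rparr>"

lemma bond_indices_cut_peps [simp]: "bond_indices (cut_peps e c P) F = bond_indices P F"
  by (simp add: bond_indices_def cut_peps_def)

lemma blocked_tensor_cut_peps: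
  assumes "\<not> e \<subseteq> R" and "e \<in> E" and "\<And>s. s \<in> e \<Longrightarrow> s \<in> R \<Longrightarrow> c s = x"
  shows "blocked_tensor (E - {e}) (cut_peps e c P) R i p = blocked_tensor E P R (i(e := x)) p"
proof -
  have inner: "inner_edges (E - {e}) R = inner_edges E R"
    using assms(1) by (auto simp: inner_edges_def)
  show ?thesis
    unfolding blocked_tensor_def inner bond_indices_cut_peps
  proof (intro sum.cong prod.cong refl)
    fix k s assume s: "s \<in> R"
    let ?i = "restrict (\<lambda>e. if e \<subseteq> R then k e else i e) (edges_at (E - {e}) s)"
    let ?j = "restrict (\<lambda>e'. if e' \<subseteq> R then k e' else (i(e := x)) e') (edges_at E s)"
    have "(if s \<in> e then ?i(e := c s) else ?i) = ?j"
      using s assms by (auto simp: restrict_def edges_at_def fun_eq_iff)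
    then show "site_tensor (cut_peps e c P) s ?i (p s) = site_tensor P s ?j (p s)"
      by (simp add: cut_peps_def)
  qed
qed

lemma simple_graph_remove_edge: "simple_graph V E \<Longrightarrow> simple_graph V (E - {e})"
  by (auto simp: simple_graph_def)

lemma peps_state_remove_edge:
  assumes "simple_graph V E" and "e \<in> E"
  shows "peps_state V E P p = (\<Sum>x<bond_dim P e. peps_state V (E - {e}) (cut_peps e (\<lambda>_. x) P) p)"
  unfolding peps_state_def bond_indices_def sum_PiE_remove[OF assms(2)]
proof (intro sum.cong prod.cong refl)
  show "(\<Pi>\<^sub>E e\<in>E - {e}. {..<bond_dim P e}) = (\<Pi>\<^sub>E e'\<in>E - {e}. {..<bond_dim (cut_peps e (\<lambda>_. x) P) e'})" for x
    by (simp add: cut_peps_def)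
  fix x s and k :: "'a set \<Rightarrow> nat"
  let ?k = "restrict k (edges_at (E - {e}) s)"
  have "(if s \<in> e then ?k(e := x) else ?k) = restrict (k(e := x)) (edges_at E s)"
    using assms(2) by (auto simp: restrict_def edges_at_def fun_eq_iff)
  then show "site_tensor P s (restrict (k(e := x)) (edges_at E s)) (p s)
      = site_tensor (cut_peps e (\<lambda>_. x) P) s ?k (p s)"
    by (simp add: cut_peps_def)
qed

text \<open>The left-hand side does not mention \<open>R\<close>; this carries a bond gauge found with one region over to
  every other region that separates the ends of the edge.\<close>

lemma peps_state_cut_peps:
  assumes graph: "simple_graph V E" and R: "R \<subseteq> V" and e: "{u, v} \<in> E" "u \<in> R" "v \<notin> R"
  shows "peps_state V (E - {{u, v}}) (cut_peps {u, v} c P) p =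
    (\<Sum>k\<in>bond_indices P (leaving_edges E R - {{u, v}}).
      blocked_tensor E P R (k({u, v} := c u)) p * blocked_tensor E P (V - R) (k({u, v} := c v)) p)"
proof -
  let ?e = "{u, v}"
  have leave: "leaving_edges (E - {?e}) R = leaving_edges E R - {?e}"
    by (auto simp: leaving_edges_def)
  have "blocked_tensor (E - {?e}) (cut_peps ?e c P) R k p = blocked_tensor E P R (k(?e := c u)) p"
    and "blocked_tensor (E - {?e}) (cut_peps ?e c P) (V - R) k p = blocked_tensor E P (V - R) (k(?e := c v)) p"
    for k using e by (intro blocked_tensor_cut_peps; auto)+
  then show ?thesis
    unfolding peps_state_cut[OF simple_graph_remove_edge[OF graph] R] leave bond_indices_cut_peps
    by simp
qed

lemma injective_region_left_invertible:
  assumes "simple_graph V E" and "injective_region V E d P R"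
  shows "left_invertible_on (bond_indices P (leaving_edges E R)) (phys_indices d R) (blocked_tensor E P R)"
proof (rule left_invertible_on_if_independent)
  let ?I = "bond_indices P (leaving_edges E R)"
  have "finite (leaving_edges E R)"
    using simple_graph_finite_edges[OF assms(1)] by (auto simp: leaving_edges_def)
  then show "finite ?I" by simp
  show "finite (phys_indices d R)"
    using assms by (auto simp: simple_graph_def injective_region_def intro!: finite_phys_indices intro: finite_subset)
  fix x i assume x: "\<And>p. p \<in> phys_indices d R \<Longrightarrow> (\<Sum>i\<in>?I. blocked_tensor E P R i p * x i) = 0" and i: "i \<in> ?I"
  have "blocked_map E d P R (restrict x ?I) = blocked_map E d P R (\<lambda>_\<in>?I. 0)"
    unfolding blocked_map_def using x by (intro restrict_ext) (simp cong: sum.cong)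
  then have "restrict x ?I = (\<lambda>_\<in>?I. 0)"
    using assms(2) unfolding injective_region_def by (auto dest!: inj_onD)
  then show "x i = 0" using i by (metis restrict_apply')
qed

section \<open>Gauged tensors\<close>

text \<open>\<open>\<alpha>\<close> and \<open>\<beta>\<close> stand for the gauges at the two ends
  of a set of contracted bonds.\<close>

lemma contract_gauges:
  fixes f g :: "'m \<Rightarrow> complex"
  assumes "finite M"
    and "\<And>m m'. m \<in> M \<Longrightarrow> m' \<in> M \<Longrightarrow> (\<Sum>k\<in>K. \<alpha> k m * \<beta> k m') = of_bool (m = m')"
  shows "(\<Sum>k\<in>K. (\<Sum>m\<in>M. f m * \<alpha> k m) * (\<Sum>m\<in>M. g m * \<beta> k m)) = (\<Sum>m\<in>M. f m * g m)"
proof -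
  have "(\<Sum>k\<in>K. (\<Sum>m\<in>M. f m * \<alpha> k m) * (\<Sum>m\<in>M. g m * \<beta> k m))
      = (\<Sum>k\<in>K. \<Sum>m'\<in>M. \<Sum>m\<in>M. f m * g m' * (\<alpha> k m * \<beta> k m'))"
    unfolding sum_product by (rule sum.cong[OF refl], subst sum.swap) (simp add: mult_ac)
  also have "\<dots> = (\<Sum>m\<in>M. \<Sum>m'\<in>M. f m * g m' * (\<Sum>k\<in>K. \<alpha> k m * \<beta> k m'))"
    unfolding sum_distrib_left by (rule sum_swap3)
  also have "\<dots> = (\<Sum>m\<in>M. \<Sum>m'\<in>M. f m * g m' * of_bool (m = m'))"
    using assms(2) by simp
  finally show ?thesis using assms(1) by (simp add: sum_mult_delta)
qed

lemma blocked_tensor_singleton: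
  assumes "simple_graph V E"
  shows "blocked_tensor E P {s} i p = site_tensor P s (restrict i (edges_at E s)) (p s)"
proof -
  have ne: "\<not> e \<subseteq> {s}" if "e \<in> E" for e
    using simple_graph_edgeE[OF assms that] by (metis empty_iff insert_subset singletonD)
  then have "inner_edges E {s} = {}" by (auto simp: inner_edges_def)
  moreover have "restrict (\<lambda>e. if e \<subseteq> {s} then k e else i e) (edges_at E s) = restrict i (edges_at E s)" for k
    using ne by (intro restrict_ext) (auto simp: edges_at_def)
  ultimately show ?thesis by (simp add: blocked_tensor_def bond_indices_def)
qed

text \<open>Adding \<open>s\<close> to \<open>R\<close> closes the bonds in \<open>K\<close>, keeps
  the other edges leaving \<open>R\<close>, and opens the other edges at \<open>s\<close>. Index
  sums are split along these three classes below.\<close>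

lemma leaving_edges_insert:
  assumes "simple_graph V E" and "s \<notin> R"
  defines "K \<equiv> edges_between E R {s}"
  shows "leaving_edges E R = K \<union> (leaving_edges E R - K)"
    and "edges_at E s = K \<union> (edges_at E s - K)"
    and "leaving_edges E (insert s R) = (leaving_edges E R - K) \<union> (edges_at E s - K)"
    and "(leaving_edges E R - K) \<inter> (edges_at E s - K) = {}"
    and "e \<in> K \<Longrightarrow> e \<in> E \<and> (\<exists>t\<in>R. e = {t, s})"
    and "e \<in> leaving_edges E R - K \<Longrightarrow> e \<inter> insert s R = e \<inter> R"
    and "e \<in> edges_at E s - K \<Longrightarrow> e \<inter> insert s R = {s}"
    and "leaving_edges E {s} = edges_at E s"
proof -
  have edge: "\<exists>u v. e = {u, v} \<and> u \<noteq> v" if "e \<in> E" for e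
    using simple_graph_edgeE[OF assms(1) that] by metis
  show "leaving_edges E R = K \<union> (leaving_edges E R - K)"
    using assms(2) by (auto simp: K_def leaving_edges_def edges_between_def)
  show "edges_at E s = K \<union> (edges_at E s - K)"
    by (auto simp: K_def edges_at_def edges_between_def)
  show "leaving_edges E (insert s R) = (leaving_edges E R - K) \<union> (edges_at E s - K)"
  proof -
    have "e \<in> leaving_edges E (insert s R) \<longleftrightarrow> e \<in> (leaving_edges E R - K) \<union> (edges_at E s - K)" for e
    proof (cases "e \<in> E")
      case True
      then obtain u v where "e = {u, v}" "u \<noteq> v" using edge by blast
      then show ?thesis using True assms(2)
        by (auto simp: K_def leaving_edges_def edges_at_def edges_between_def)
    qed (auto simp: K_def leaving_edges_def edges_at_def edges_between_def)
    then show ?thesis by blast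
  qed
  show "(leaving_edges E R - K) \<inter> (edges_at E s - K) = {}"
    by (auto simp: K_def leaving_edges_def edges_at_def edges_between_def)
  show "e \<in> E \<and> (\<exists>t\<in>R. e = {t, s})" if "e \<in> K"
    using that simple_graph_edge_cases[OF assms(1)] assms(2)
    by (fastforce simp: K_def edges_between_def)
  show "e \<inter> insert s R = e \<inter> R" if "e \<in> leaving_edges E R - K"
    using that by (auto simp: K_def leaving_edges_def edges_between_def)
  show "e \<inter> insert s R = {s}" if "e \<in> edges_at E s - K"
    using that by (auto simp: K_def edges_at_def edges_between_def)
  show "leaving_edges E {s} = edges_at E s"
    using edge by (fastforce simp: leaving_edges_def edges_at_def)
qed

text \<open>\<open>the_elem (e \<inter> R)\<close> is the end inside \<open>R\<close> of an edge \<open>e\<close> leaving \<open>R\<close>.\<close>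

definition boundary_gauge ::
  "('v \<Rightarrow> 'v set \<Rightarrow> nat \<Rightarrow> nat \<Rightarrow> complex) \<Rightarrow> 'v set \<Rightarrow> 'v set \<Rightarrow> nat \<Rightarrow> nat \<Rightarrow> complex" where
  "boundary_gauge z R e = z (the_elem (e \<inter> R)) e"

lemma blocked_tensor_gauge:
  assumes graph: "simple_graph V E" and "R \<subseteq> V"
    and cancel: "\<And>u v y y'. {u, v} \<in> E \<Longrightarrow> y < bond_dim B {u, v} \<Longrightarrow> y' < bond_dim B {u, v} \<Longrightarrow>
      (\<Sum>x<bond_dim A {u, v}. z u {u, v} y x * z v {u, v} y' x) = of_bool (y = y')"
    and site: "\<And>s i. s \<in> R \<Longrightarrow> i \<in> bond_indices A (edges_at E s) \<Longrightarrow>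
      site_tensor A s i (p s)
      = (\<Sum>j\<in>bond_indices B (edges_at E s). site_tensor B s j (p s) * (\<Prod>e\<in>edges_at E s. z s e (j e) (i e)))"
    and i: "\<And>e. e \<in> leaving_edges E R \<Longrightarrow> i e < bond_dim A e"
  shows "blocked_tensor E A R i p
    = (\<Sum>j\<in>bond_indices B (leaving_edges E R). blocked_tensor E B R j p *
        (\<Prod>e\<in>leaving_edges E R. boundary_gauge z R e (j e) (i e)))"
proof -
  have "finite R" using graph assms(2) by (auto simp: simple_graph_def intro: finite_subset)
  then show ?thesis using assms(2) site i
  proof (induction R arbitrary: i)
    case empty
    have "leaving_edges E {} = {}" by (simp add: leaving_edges_def)
    moreover have "inner_edges E {} = {}"
      using graph by (auto simp: inner_edges_def simple_graph_def)
    ultimately show ?case by (simp add: blocked_tensor_def bond_indices_def)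
  next
    case (insert s R)
    define K where "K = edges_between E R {s}"
    define L where "L = leaving_edges E R - K"
    define M where "M = edges_at E s - K"
    note ins = leaving_edges_insert[OF graph insert.hyps(2), folded K_def, folded L_def M_def]
    have disj: "K \<inter> L = {}" "K \<inter> M = {}" by (auto simp: L_def M_def)
    have fin: "finite K" "finite L" "finite M"
      using simple_graph_finite_edges[OF graph]
      by (auto simp: K_def L_def M_def edges_between_def leaving_edges_def edges_at_def)
    let ?I = "\<lambda>F. bond_indices A F" and ?J = "\<lambda>F. bond_indices B F"
    have KI: "k e < bond_dim A e" if "k \<in> ?I K" "e \<in> K" for k e
      using that by (auto simp: bond_indices_def PiE_iff)
    have iLM: "i e < bond_dim A e" if "e \<in> L \<union> M" for e
      using insert.prems(3) that ins(3) by blast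
    \<comment> \<open>The gauge factors by class of bond: \<open>\<alpha>\<close> and
      \<open>\<beta>\<close> on the newly contracted bonds, seen from \<open>R\<close> and from
      \<open>s\<close>; \<open>\<gamma>\<close> on the bonds that stay open, \<open>\<delta>\<close>
      on those opened by \<open>s\<close>.\<close>
    define \<alpha> where "\<alpha> k m = (\<Prod>e\<in>K. boundary_gauge z R e (m e) (k e))" for k m :: "'a set \<Rightarrow> nat"
    define \<beta> where "\<beta> k m = (\<Prod>e\<in>K. z s e (m e) (k e))" for k m :: "'a set \<Rightarrow> nat"
    define \<gamma> where "\<gamma> l = (\<Prod>e\<in>L. boundary_gauge z R e (l e) (i e))" for l :: "'a set \<Rightarrow> nat"
    define \<delta> where "\<delta> l = (\<Prod>e\<in>M. z s e (l e) (i e))" for l :: "'a set \<Rightarrow> nat"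
    have IH: "blocked_tensor E A R (override_on i k K) p
        = (\<Sum>m\<in>?J K. (\<Sum>l\<in>?J L. blocked_tensor E B R (override_on l m K) p * \<gamma> l) * \<alpha> k m)"
      if k: "k \<in> ?I K" for k
    proof -
      have "blocked_tensor E A R (override_on i k K) p
        = (\<Sum>j\<in>?J (leaving_edges E R). blocked_tensor E B R j p *
            (\<Prod>e\<in>leaving_edges E R. boundary_gauge z R e (j e) (override_on i k K e)))"
      proof (rule insert.IH)
        show "override_on i k K e < bond_dim A e" if "e \<in> leaving_edges E R" for e
          using that KI[OF k] iLM[of e] ins(1) by (cases "e \<in> K") auto
      qed (use insert.prems in auto)
      also have "\<dots> = (\<Sum>m\<in>?J K. \<Sum>l\<in>?J L. blocked_tensor E B R (override_on l m K) p * (\<alpha> k m * \<gamma> l))"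
      proof -
        have "(\<Prod>e\<in>K \<union> L. boundary_gauge z R e (override_on l m K e) (override_on i k K e)) = \<alpha> k m * \<gamma> l" for l m
        proof -
          have "(\<Prod>e\<in>L. boundary_gauge z R e (override_on l m K e) (override_on i k K e)) = \<gamma> l"
            unfolding \<gamma>_def using disj by (intro prod.cong refl) (auto simp: override_on_def)
          then show ?thesis
            unfolding prod.union_disjoint[OF fin(1,2) disj(1)] by (simp add: \<alpha>_def)
        qed
        then show ?thesis
          unfolding bond_indices_def by (subst ins(1), subst sum_PiE_Un[OF disj(1)], subst ins(1)) simp
      qed
      finally show ?thesis unfolding sum_distrib_right by (simp add: mult_ac)
    qed
    have site: "blocked_tensor E A {s} (override_on i k K) p
        = (\<Sum>m\<in>?J K. (\<Sum>l\<in>?J M. blocked_tensor E B {s} (override_on l m K) p * \<delta> l) * \<beta> k m)"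
      if k: "k \<in> ?I K" for k
    proof -
      let ?i = "restrict (override_on i k K) (edges_at E s)"
      have "?i \<in> ?I (edges_at E s)"
      proof -
        have "override_on i k K e < bond_dim A e" if "e \<in> edges_at E s" for e
          using that KI[OF k] iLM[of e] ins(2) by (cases "e \<in> K") auto
        then show ?thesis by (auto simp: bond_indices_def)
      qed
      then have "blocked_tensor E A {s} (override_on i k K) p
        = (\<Sum>j\<in>?J (edges_at E s). blocked_tensor E B {s} j p *
            (\<Prod>e\<in>edges_at E s. z s e (j e) (override_on i k K e)))"
        unfolding blocked_tensor_singleton[OF graph]
        by (subst insert.prems(2)) (auto simp: bond_indices_def intro!: sum.cong)
      also have "\<dots> = (\<Sum>m\<in>?J K. \<Sum>l\<in>?J M. blocked_tensor E B {s} (override_on l m K) p * (\<beta> k m * \<delta> l))"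
      proof -
        have "(\<Prod>e\<in>K \<union> M. z s e (override_on l m K e) (override_on i k K e)) = \<beta> k m * \<delta> l" for l m
        proof -
          have "(\<Prod>e\<in>M. z s e (override_on l m K e) (override_on i k K e)) = \<delta> l"
            unfolding \<delta>_def using disj by (intro prod.cong refl) (auto simp: override_on_def)
          then show ?thesis
            unfolding prod.union_disjoint[OF fin(1,3) disj(2)] by (simp add: \<beta>_def)
        qed
        then show ?thesis
          unfolding bond_indices_def by (subst ins(2), subst sum_PiE_Un[OF disj(2)], subst ins(2)) simp
      qed
      finally show ?thesis unfolding sum_distrib_right by (simp add: mult_ac)
    qed
    \<comment> \<open>The sum over joint indices of a product over bonds is the product of the sums
      on the single bonds, each of which is a Kronecker delta by \<open>cancel\<close>.\<close>
    have \<alpha>\<beta>: "(\<Sum>k\<in>?I K. \<alpha> k m * \<beta> k m') = of_bool (m = m')" if m: "m \<in> ?J K" "m' \<in> ?J K" for m m'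
    proof -
      have "(\<Sum>k\<in>?I K. \<alpha> k m * \<beta> k m')
          = (\<Prod>e\<in>K. \<Sum>x<bond_dim A e. boundary_gauge z R e (m e) x * z s e (m' e) x)"
        unfolding \<alpha>_def \<beta>_def bond_indices_def using fin(1)
        by (subst prod_sum_PiE) (auto simp: prod.distrib)
      also have "\<dots> = (\<Prod>e\<in>K. of_bool (m e = m' e))"
      proof (intro prod.cong refl)
        fix e assume e: "e \<in> K"
        then obtain t where t: "t \<in> R" "e = {t, s}" "e \<in> E" using ins(5) by blast
        then have "e \<inter> R = {t}" using insert.hyps(2) by auto
        then have "boundary_gauge z R e = z t e" by (simp add: boundary_gauge_def)
        moreover have "m e < bond_dim B e" "m' e < bond_dim B e"
          using m e by (auto simp: bond_indices_def PiE_iff)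
        ultimately show "(\<Sum>x<bond_dim A e. boundary_gauge z R e (m e) x * z s e (m' e) x) = of_bool (m e = m' e)"
          using cancel[of t s "m e" "m' e"] t by simp
      qed
      also have "\<dots> = of_bool (\<forall>e\<in>K. m e = m' e)"
        using fin(1) by (induction K) auto
      also have "(\<forall>e\<in>K. m e = m' e) \<longleftrightarrow> m = m'"
        using m unfolding bond_indices_def by (metis PiE_ext)
      finally show ?thesis .
    qed
    have KR: "edges_between E R {s} = K" by (simp add: K_def)
    have RsV: "R \<union> {s} \<subseteq> V" "R \<inter> {s} = {}" using insert by auto
    have blocked: "blocked_tensor E Q (insert s R) j p
        = (\<Sum>k\<in>bond_indices Q K. blocked_tensor E Q R (override_on j k K) p * blocked_tensor E Q {s} (override_on j k K) p)"
      for Q j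
      using blocked_tensor_Un[OF graph RsV, of Q j p] by (simp add: KR)
    have "blocked_tensor E A (insert s R) i p
        = (\<Sum>k\<in>?I K. (\<Sum>m\<in>?J K. (\<Sum>l\<in>?J L. blocked_tensor E B R (override_on l m K) p * \<gamma> l) * \<alpha> k m)
          * (\<Sum>m\<in>?J K. (\<Sum>l\<in>?J M. blocked_tensor E B {s} (override_on l m K) p * \<delta> l) * \<beta> k m))"
      unfolding blocked by (simp add: IH site)
    also have "\<dots> = (\<Sum>m\<in>?J K. (\<Sum>l\<in>?J L. blocked_tensor E B R (override_on l m K) p * \<gamma> l)
          * (\<Sum>l\<in>?J M. blocked_tensor E B {s} (override_on l m K) p * \<delta> l))"
      using fin \<alpha>\<beta> by (intro contract_gauges) auto
    also have "\<dots> = (\<Sum>l\<in>?J L. \<Sum>l'\<in>?J M. \<Sum>m\<in>?J K.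
        blocked_tensor E B R (override_on l m K) p * blocked_tensor E B {s} (override_on l' m K) p * (\<gamma> l * \<delta> l'))"
      unfolding sum_product by (subst sum_swap3, subst sum.swap) (simp add: mult_ac)
    also have "\<dots> = (\<Sum>l\<in>?J L. \<Sum>l'\<in>?J M. blocked_tensor E B (insert s R) (override_on l' l L) p * (\<gamma> l * \<delta> l'))"
    proof (intro sum.cong refl)
      fix l l' assume "l \<in> ?J L" "l' \<in> ?J M"
      have "blocked_tensor E B R (override_on (override_on l' l L) m K) p = blocked_tensor E B R (override_on l m K) p"
        "blocked_tensor E B {s} (override_on (override_on l' l L) m K) p = blocked_tensor E B {s} (override_on l' m K) p" for m
        using ins(1,2,4,8) by (auto intro!: blocked_tensor_cong simp: override_on_def)
      then show "(\<Sum>m\<in>?J K. blocked_tensor E B R (override_on l m K) p * blocked_tensor E B {s} (override_on l' m K) p * (\<gamma> l * \<delta> l'))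
          = blocked_tensor E B (insert s R) (override_on l' l L) p * (\<gamma> l * \<delta> l')"
        unfolding blocked by (simp add: sum_distrib_right)
    qed
    also have "\<dots> = (\<Sum>j\<in>?J (leaving_edges E (insert s R)). blocked_tensor E B (insert s R) j p *
        (\<Prod>e\<in>leaving_edges E (insert s R). boundary_gauge z (insert s R) e (j e) (i e)))"
    proof -
      have "(\<Prod>e\<in>L \<union> M. boundary_gauge z (insert s R) e (override_on l' l L e) (i e)) = \<gamma> l * \<delta> l'" for l l'
      proof -
        have "(\<Prod>e\<in>L. boundary_gauge z (insert s R) e (override_on l' l L e) (i e)) = \<gamma> l"
          unfolding \<gamma>_def boundary_gauge_def using ins(6) by (intro prod.cong refl) auto
        moreover have "(\<Prod>e\<in>M. boundary_gauge z (insert s R) e (override_on l' l L e) (i e)) = \<delta> l'"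
          unfolding \<delta>_def boundary_gauge_def using ins(4,7) by (intro prod.cong refl) (auto simp: override_on_def)
        ultimately show ?thesis
          unfolding prod.union_disjoint[OF fin(2,3) ins(4)] by simp
      qed
      then show ?thesis
        unfolding bond_indices_def ins(3) sum_PiE_Un[OF ins(4)] by simp
    qed
    finally show ?case .
  qed
qed

text \<open>Write the block of \<open>insert s R\<close> as the block of \<open>R\<close> contracted
  with the tensor at \<open>s\<close>, for \<open>A\<close> and for \<open>C\<close>. Replacing the
  block of \<open>R\<close> in \<open>C\<close> by that of \<open>A\<close> costs \<open>c1\<close>,
  and cancelling this independent block leaves the tensors at \<open>s\<close> with ratio
  \<open>c2 / c1\<close>.\<close>

lemma site_tensor_proportional:
  assumes graph: "simple_graph V E" and "is_peps E A" and sR: "s \<notin> R" "insert s R \<subseteq> V"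
    and dims: "\<And>e. e \<in> E \<Longrightarrow> bond_dim C e = bond_dim A e"
    and inj: "left_invertible_on (bond_indices A (leaving_edges E R)) (phys_indices d R) (blocked_tensor E A R)"
    and c1: "c1 \<noteq> 0" "\<And>i p. i \<in> bond_indices A (leaving_edges E R) \<Longrightarrow> p \<in> phys_indices d R \<Longrightarrow>
      blocked_tensor E A R i p = c1 * blocked_tensor E C R i p"
    and c2: "\<And>i p. i \<in> bond_indices A (leaving_edges E (insert s R)) \<Longrightarrow> p \<in> phys_indices d (insert s R) \<Longrightarrow>
      blocked_tensor E A (insert s R) i p = c2 * blocked_tensor E C (insert s R) i p"
    and i: "i \<in> bond_indices A (edges_at E s)" and q: "q < d s"
  shows "site_tensor A s i q = c2 / c1 * site_tensor C s i q"
proof -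
  define K where "K = edges_between E R {s}"
  define L where "L = leaving_edges E R - K"
  define M where "M = edges_at E s - K"
  note ins = leaving_edges_insert[OF graph sR(1), folded K_def, folded L_def M_def]
  have disj: "K \<inter> L = {}" "K \<inter> M = {}" by (auto simp: L_def M_def)
  have sub: "K \<subseteq> E" "L \<subseteq> E" "M \<subseteq> E"
    by (auto simp: K_def L_def M_def edges_between_def leaving_edges_def edges_at_def)
  have fin: "finite K" using sub(1) simple_graph_finite_edges[OF graph] finite_subset by blast
  have C: "bond_indices C K = bond_indices A K"
    unfolding bond_indices_def using sub(1) dims by (intro PiE_cong) auto
  \<comment> \<open>Only the bonds between \<open>R\<close> and \<open>s\<close> take part in the
    cancellation. The other bonds leaving \<open>R\<close> are frozen to one index \<open>l\<close>,
    which leaves a subfamily of an independent family.\<close>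
  obtain l where l: "l \<in> bond_indices A L"
    using bond_indices_nonempty[OF assms(2) sub(2)] by blast
  define i' where "i' = override_on i l L"
  have i': "restrict i' (leaving_edges E (insert s R)) \<in> bond_indices A (leaving_edges E (insert s R))"
    using i l ins(2,4) unfolding ins(3) by (fastforce simp: bond_indices_def PiE_iff i'_def override_on_def)
  have RsV: "R \<union> {s} \<subseteq> V" "R \<inter> {s} = {}" using sR by auto
  have blocked: "blocked_tensor E Q (insert s R) j p
      = (\<Sum>k\<in>bond_indices Q K. blocked_tensor E Q R (override_on j k K) p * blocked_tensor E Q {s} (override_on j k K) p)"
    for Q j p
    using blocked_tensor_Un[OF graph RsV, of Q j p] by (simp add: K_def)
  have mem: "override_on l k K \<in> bond_indices A (leaving_edges E R)" if "k \<in> bond_indices A K" for k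
    using that l disj by (subst ins(1)) (auto simp: bond_indices_def override_on_def PiE_iff extensional_def)
  have inj_K: "left_invertible_on (bond_indices A K) (phys_indices d R) (\<lambda>k. blocked_tensor E A R (override_on l k K))"
  proof (rule left_invertible_on_reindex[OF inj])
    show "inj_on (\<lambda>k. override_on l k K) (bond_indices A K)"
    proof (rule inj_onI)
      fix k k' assume k: "k \<in> bond_indices A K" "k' \<in> bond_indices A K"
        and eq: "override_on l k K = override_on l k' K"
      have "k e = k' e" if "e \<in> K" for e using fun_cong[OF eq, of e] that by simp
      with k show "k = k'" unfolding bond_indices_def by (metis PiE_ext)
    qed
    show "(\<lambda>k. override_on l k K) ` bond_indices A K \<subseteq> bond_indices A (leaving_edges E R)"
      using mem by blast
  qed
  have "site_tensor A s (restrict (override_on i' k K) (edges_at E s)) q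
      = c2 / c1 * site_tensor C s (restrict (override_on i' k K) (edges_at E s)) q" if k: "k \<in> bond_indices A K" for k
  proof (rule left_invertible_on_cancel[OF inj_K _ k])
    show "finite (bond_indices A K)" using fin by simp
    fix p assume p: "p \<in> phys_indices d R"
    define p' where "p' = p(s := q)"
    have p': "p' \<in> phys_indices d (insert s R)"
      using p q by (auto simp: phys_indices_def p'_def PiE_iff extensional_def)
    have R: "blocked_tensor E Q R (override_on i' k K) p' = blocked_tensor E Q R (override_on l k K) p" for Q k
      using sR(1) ins(1) by (intro blocked_tensor_cong) (auto simp: p'_def i'_def override_on_def)
    have s: "blocked_tensor E Q {s} (override_on i' k K) p' = site_tensor Q s (restrict (override_on i' k K) (edges_at E s)) q" for Q k
      by (simp add: blocked_tensor_singleton[OF graph] p'_def)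
    have cong: "blocked_tensor E Q (insert s R) (restrict i' (leaving_edges E (insert s R))) p'
        = blocked_tensor E Q (insert s R) i' p'" for Q
      by (rule blocked_tensor_cong) auto
    have "blocked_tensor E A (insert s R) i' p' = c2 * blocked_tensor E C (insert s R) i' p'"
      using c2[OF i' p'] by (simp add: cong)
    then have "(\<Sum>k\<in>bond_indices A K. site_tensor A s (restrict (override_on i' k K) (edges_at E s)) q * blocked_tensor E A R (override_on l k K) p)
        = c2 * (\<Sum>k\<in>bond_indices A K. site_tensor C s (restrict (override_on i' k K) (edges_at E s)) q * blocked_tensor E C R (override_on l k K) p)"
      unfolding blocked R s C by (simp add: mult.commute)
    also have "\<dots> = (\<Sum>k\<in>bond_indices A K. c2 / c1 * site_tensor C s (restrict (override_on i' k K) (edges_at E s)) q * blocked_tensor E A R (override_on l k K) p)"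
      unfolding sum_distrib_left using c1(1) c1(2)[OF mem p] by (intro sum.cong refl) simp
    finally show "(\<Sum>k\<in>bond_indices A K. site_tensor A s (restrict (override_on i' k K) (edges_at E s)) q * blocked_tensor E A R (override_on l k K) p)
        = (\<Sum>k\<in>bond_indices A K. c2 / c1 * site_tensor C s (restrict (override_on i' k K) (edges_at E s)) q * blocked_tensor E A R (override_on l k K) p)" .
  qed
  moreover have "restrict i K \<in> bond_indices A K"
    using i ins(2) by (auto simp: bond_indices_def PiE_iff)
  moreover have "restrict (override_on i' (restrict i K) K) (edges_at E s) = i"
  proof
    fix e
    show "restrict (override_on i' (restrict i K) K) (edges_at E s) e = i e"
      using i ins(2,4) unfolding i'_def
      by (auto simp: bond_indices_def PiE_iff extensional_def override_on_def)
  qed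
  ultimately show ?thesis by metis
qed

section \<open>Bond gauges from tripartitions\<close>

text \<open>Since \<open>e\<close> is the only edge between \<open>R1\<close> and \<open>R2\<close>,
  every other edge leaving one of them ends in \<open>R3\<close>; these edges form the two remaining
  bonds of the ring.\<close>

lemma tripartite_edges:
  assumes graph: "simple_graph V E" and tri: "tripartite_injective_mps V E d P e R1 R2 R3"
  shows "e \<in> E" and "\<exists>u\<in>R1. \<exists>v\<in>R2. e = {u, v} \<and> u \<noteq> v"
    and "e \<in> leaving_edges E R1" and "e \<in> leaving_edges E R2"
    and "leaving_edges E R3 = (leaving_edges E R1 - {e}) \<union> (leaving_edges E R2 - {e})"
    and "(leaving_edges E R1 - {e}) \<inter> (leaving_edges E R2 - {e}) = {}"
    and "edges_between E R2 R3 = leaving_edges E R2 - {e}"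
    and "V - R1 = R2 \<union> R3"
proof -
  have part: "R1 \<union> R2 \<union> R3 = V" "R1 \<inter> R2 = {}" "R1 \<inter> R3 = {}" "R2 \<inter> R3 = {}"
    and e12: "edges_between E R1 R2 = {e}"
    using tri by (auto simp: tripartite_injective_mps_def)
  have "e \<in> edges_between E R1 R2" using e12 by simp
  then obtain u v where uv: "e \<in> E" "u \<in> e" "u \<in> R1" "v \<in> e" "v \<in> R2"
    by (auto simp: edges_between_def)
  have uv': "u \<noteq> v" using uv part by auto
  have e: "e = {u, v}" using simple_graph_edge_cases[OF graph uv(1,2,4) uv'] .
  have only: "f = e" if "f \<in> E" "f \<inter> R1 \<noteq> {}" "f \<inter> R2 \<noteq> {}" for f
    using e12 that by (auto simp: edges_between_def)
  have edge: "\<exists>a b. f = {a, b} \<and> a \<noteq> b \<and> a \<in> R1 \<union> R2 \<union> R3 \<and> b \<in> R1 \<union> R2 \<union> R3" if "f \<in> E" for f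
    using simple_graph_edgeE[OF graph that] part(1) by metis
  have l12: "e \<in> leaving_edges E R1" "e \<in> leaving_edges E R2"
    using uv e part by (auto simp: leaving_edges_def)
  have iff: "f \<in> leaving_edges E R3 \<longleftrightarrow> f \<in> (leaving_edges E R1 - {e}) \<union> (leaving_edges E R2 - {e})"
    "f \<in> (leaving_edges E R1 - {e}) \<Longrightarrow> f \<in> (leaving_edges E R2 - {e}) \<Longrightarrow> False"
    "f \<in> edges_between E R2 R3 \<longleftrightarrow> f \<in> leaving_edges E R2 - {e}" for f
  proof -
    have "(f \<in> leaving_edges E R3 \<longleftrightarrow> f \<in> (leaving_edges E R1 - {e}) \<union> (leaving_edges E R2 - {e})) \<and>
      \<not> (f \<in> (leaving_edges E R1 - {e}) \<and> f \<in> (leaving_edges E R2 - {e})) \<and>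
      (f \<in> edges_between E R2 R3 \<longleftrightarrow> f \<in> leaving_edges E R2 - {e})"
    proof (cases "f \<in> E")
      case True
      then obtain a b where ab: "f = {a, b}" "a \<noteq> b" "a \<in> R1 \<union> R2 \<union> R3" "b \<in> R1 \<union> R2 \<union> R3"
        using edge by blast
      have disj: "x \<in> R1 \<Longrightarrow> x \<notin> R2" "x \<in> R1 \<Longrightarrow> x \<notin> R3" "x \<in> R2 \<Longrightarrow> x \<notin> R3" for x
        using part by auto
      show ?thesis
      proof (cases "f = e")
        case True
        then show ?thesis using uv e disj by (auto simp: leaving_edges_def edges_between_def)
      next
        case False
        then have "f \<inter> R1 = {} \<or> f \<inter> R2 = {}" using only True by blast
        then show ?thesis using True False ab disj
          by (auto simp: leaving_edges_def edges_between_def)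
      qed
    qed (auto simp: leaving_edges_def edges_between_def)
    then show "f \<in> leaving_edges E R3 \<longleftrightarrow> f \<in> (leaving_edges E R1 - {e}) \<union> (leaving_edges E R2 - {e})"
      "f \<in> (leaving_edges E R1 - {e}) \<Longrightarrow> f \<in> (leaving_edges E R2 - {e}) \<Longrightarrow> False"
      "f \<in> edges_between E R2 R3 \<longleftrightarrow> f \<in> leaving_edges E R2 - {e}" by blast+
  qed
  show "e \<in> E" "\<exists>u\<in>R1. \<exists>v\<in>R2. e = {u, v} \<and> u \<noteq> v" using uv e uv' by blast+
  show "e \<in> leaving_edges E R1" "e \<in> leaving_edges E R2" by (rule l12)+
  show "leaving_edges E R3 = (leaving_edges E R1 - {e}) \<union> (leaving_edges E R2 - {e})"
    using iff(1) by blast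
  show "(leaving_edges E R1 - {e}) \<inter> (leaving_edges E R2 - {e}) = {}"
    using iff(2) by blast
  show "edges_between E R2 R3 = leaving_edges E R2 - {e}" using iff(3) by blast
  show "V - R1 = R2 \<union> R3" using part by auto
qed

text \<open>The joint open index is split into the index of \<open>e\<close> and the rest, as the
  tensors of \<open>injective_ring\<close> require.\<close>

definition block_at_edge ::
  "'v set set \<Rightarrow> 'v peps \<Rightarrow> 'v set \<Rightarrow> 'v set \<Rightarrow> nat \<Rightarrow> ('v set \<Rightarrow> nat) \<Rightarrow> ('v \<Rightarrow> nat) \<Rightarrow> complex" where
  "block_at_edge E P e R x f = blocked_tensor E P R (f(e := x))"

text \<open>Used for \<open>R3\<close>, where \<open>G\<close> is the bond to \<open>R2\<close> with
  index \<open>g\<close>, and \<open>f\<close> is the index of the bond to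
  \<open>R1\<close>.\<close>

definition block_opposite ::
  "'v set set \<Rightarrow> 'v peps \<Rightarrow> 'v set set \<Rightarrow> 'v set \<Rightarrow> ('v set \<Rightarrow> nat) \<Rightarrow> ('v set \<Rightarrow> nat) \<Rightarrow> ('v \<Rightarrow> nat) \<Rightarrow> complex" where
  "block_opposite E P G R f g = blocked_tensor E P R (override_on f g G)"

lemma injective_ring_of_tripartite:
  assumes graph: "simple_graph V E" and peps: "is_peps E P"
    and tri: "tripartite_injective_mps V E d P e R1 R2 R3"
  shows "injective_ring {..<bond_dim P e} (bond_indices P (leaving_edges E R1 - {e}))
    (bond_indices P (leaving_edges E R2 - {e})) (phys_indices d R1) (phys_indices d R2) (phys_indices d R3)
    (block_at_edge E P e R1) (block_at_edge E P e R2) (block_opposite E P (leaving_edges E R2 - {e}) R3)"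
proof -
  note e = tripartite_edges(1,3,4)[OF graph tri]
  note l3 = tripartite_edges(5,6)[OF graph tri]
  have sub: "leaving_edges E R - {e} \<subseteq> E" for R by (auto simp: leaving_edges_def)
  have fin: "finite (leaving_edges E R - {e})" for R
    using simple_graph_finite_edges[OF graph] by (auto simp: leaving_edges_def)
  have inj: "injective_region V E d P R1" "injective_region V E d P R2" "injective_region V E d P R3"
    using tri by (auto simp: tripartite_injective_mps_def)
  have edge: "left_invertible_on ({..<bond_dim P e} \<times> bond_indices P (leaving_edges E R - {e}))
      (phys_indices d R) (\<lambda>(x, f). block_at_edge E P e R x f)"
    if R: "injective_region V E d P R" "e \<in> leaving_edges E R" for R
  proof -
    have "left_invertible_on ({..<bond_dim P e} \<times> bond_indices P (leaving_edges E R - {e})) (phys_indices d R)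
        (\<lambda>i. blocked_tensor E P R ((\<lambda>(x, f). f(e := x)) i))"
    proof (rule left_invertible_on_reindex[OF injective_region_left_invertible[OF graph R(1)]])
      show "inj_on (\<lambda>(x, f). f(e := x)) ({..<bond_dim P e} \<times> bond_indices P (leaving_edges E R - {e}))"
        unfolding bond_indices_def
        using inj_combinator[of e "leaving_edges E R - {e}" "\<lambda>e. {..<bond_dim P e}"] by simp
      have "f(e := x) \<in> bond_indices P (insert e (leaving_edges E R - {e}))"
        if "x < bond_dim P e" "f \<in> bond_indices P (leaving_edges E R - {e})" for x f
        using that unfolding bond_indices_def by (intro PiE_fun_upd) simp_all
      moreover have "insert e (leaving_edges E R - {e}) = leaving_edges E R" using R(2) by blast
      ultimately show "(\<lambda>(x, f). f(e := x)) ` ({..<bond_dim P e} \<times> bond_indices P (leaving_edges E R - {e}))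
          \<subseteq> bond_indices P (leaving_edges E R)"
        by auto
    qed
    then show ?thesis by (simp add: block_at_edge_def case_prod_unfold)
  qed
  let ?F = "leaving_edges E R1 - {e}" and ?G = "leaving_edges E R2 - {e}"
  have opposite: "left_invertible_on (bond_indices P ?F \<times> bond_indices P ?G) (phys_indices d R3)
      (\<lambda>(f, g). block_opposite E P ?G R3 f g)"
  proof -
    have "left_invertible_on (bond_indices P ?F \<times> bond_indices P ?G) (phys_indices d R3)
        (\<lambda>i. blocked_tensor E P R3 ((\<lambda>(f, g). override_on f g ?G) i))"
    proof (rule left_invertible_on_reindex[OF injective_region_left_invertible[OF graph inj(3)]])
      show "inj_on (\<lambda>(f, g). override_on f g ?G) (bond_indices P ?F \<times> bond_indices P ?G)"
      proof (rule inj_onI)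
        fix i j assume i: "i \<in> bond_indices P ?F \<times> bond_indices P ?G"
          and j: "j \<in> bond_indices P ?F \<times> bond_indices P ?G"
          and eq: "(\<lambda>(f, g). override_on f g ?G) i = (\<lambda>(f, g). override_on f g ?G) j"
        have eq': "override_on (fst i) (snd i) ?G a = override_on (fst j) (snd j) ?G a" for a
          using fun_cong[OF eq, of a] by (simp add: case_prod_unfold)
        have "fst i a = fst j a" if "a \<in> ?F" for a
          using eq'[of a] that l3(2) by (auto simp: override_on_def split: if_splits)
        moreover have "snd i a = snd j a" if "a \<in> ?G" for a
          using eq'[of a] that by (simp add: override_on_def)
        moreover have "fst i \<in> bond_indices P ?F" "fst j \<in> bond_indices P ?F"
          "snd i \<in> bond_indices P ?G" "snd j \<in> bond_indices P ?G"
          using i j by auto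
        ultimately have "fst i = fst j" "snd i = snd j"
          unfolding bond_indices_def by (auto intro: PiE_ext)
        then show "i = j" by (rule prod_eqI)
      qed
      have mem: "override_on f g ?G \<in> bond_indices P (?F \<union> ?G)"
        if fg: "f \<in> bond_indices P ?F" "g \<in> bond_indices P ?G" for f g
        unfolding bond_indices_def
      proof (rule PiE_I)
        fix a assume a: "a \<in> ?F \<union> ?G"
        show "override_on f g ?G a \<in> {..<bond_dim P a}"
        proof (cases "a \<in> ?G")
          case True
          then show ?thesis
            using PiE_mem[OF fg(2)[unfolded bond_indices_def] True]
            unfolding override_on_apply_in[OF True] by blast
        next
          case False
          then have "a \<in> ?F" using a by blast
          then have "f a \<in> {..<bond_dim P a}"
            by (rule PiE_mem[OF fg(1)[unfolded bond_indices_def]])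
          then show ?thesis unfolding override_on_apply_notin[OF False] .
        qed
      next
        fix a assume a: "a \<notin> ?F \<union> ?G"
        then have "a \<notin> ?F" "a \<notin> ?G" by blast+
        then show "override_on f g ?G a = undefined"
          using PiE_arb[OF fg(1)[unfolded bond_indices_def]] unfolding override_on_apply_notin[OF \<open>a \<notin> ?G\<close>] by blast
      qed
      show "(\<lambda>(f, g). override_on f g ?G) ` (bond_indices P ?F \<times> bond_indices P ?G)
          \<subseteq> bond_indices P (leaving_edges E R3)"
      proof (rule image_subsetI)
        fix i assume "i \<in> bond_indices P ?F \<times> bond_indices P ?G"
        then have "override_on (fst i) (snd i) ?G \<in> bond_indices P (?F \<union> ?G)"
          by (intro mem) (simp_all only: mem_Times_iff)
        then show "(\<lambda>(f, g). override_on f g ?G) i \<in> bond_indices P (leaving_edges E R3)"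
          unfolding l3(1) by (simp only: case_prod_unfold)
      qed
    qed
    then show ?thesis by (simp add: block_opposite_def case_prod_unfold)
  qed
  show ?thesis
  proof
    show "{..<bond_dim P e} \<noteq> {}" using peps e(1) by (auto simp: is_peps_def)
    show "bond_indices P ?F \<noteq> {}" "bond_indices P ?G \<noteq> {}"
      by (rule bond_indices_nonempty[OF peps sub])+
    show "finite {..<bond_dim P e}" "finite (bond_indices P ?F)" "finite (bond_indices P ?G)"
      using fin by simp_all
  qed (rule edge[OF inj(1) e(2)] edge[OF inj(2) e(3)] opposite)+
qed

text \<open>Translates the opened ring into a state in which the blocks no longer occur; this is
  what frees the bond gauge from the tripartition.\<close>

lemma cut_state_of_tripartite:
  assumes graph: "simple_graph V E" and peps: "is_peps E P"
    and tri: "tripartite_injective_mps V E d P {u, v} R1 R2 R3"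
    and uv: "u \<in> R1" "v \<in> R2"
    and t: "\<And>s. s \<in> R1 \<Longrightarrow> t s = p s" "\<And>s. s \<in> R2 \<Longrightarrow> t s = q s" "\<And>s. s \<in> R3 \<Longrightarrow> t s = r s"
  shows "injective_ring.cut_state (bond_indices P (leaving_edges E R1 - {{u, v}}))
      (bond_indices P (leaving_edges E R2 - {{u, v}}))
      (block_at_edge E P {u, v} R1) (block_at_edge E P {u, v} R2)
      (block_opposite E P (leaving_edges E R2 - {{u, v}}) R3) (c u) (c v) p q r
    = peps_state V (E - {{u, v}}) (cut_peps {u, v} c P) t"
proof -
  let ?e = "{u, v}"
  let ?F = "leaving_edges E R1 - {?e}" and ?G = "leaving_edges E R2 - {?e}"
  note e = tripartite_edges(1)[OF graph tri]
  note l3 = tripartite_edges(5,6,7,8)[OF graph tri]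
  have part: "R1 \<union> R2 \<union> R3 = V" "R1 \<inter> R2 = {}" "R2 \<inter> R3 = {}"
    using tri by (auto simp: tripartite_injective_mps_def)
  have v: "v \<notin> R1" and V: "R1 \<subseteq> V" "R2 \<union> R3 \<subseteq> V" using part uv by auto
  have l2: "leaving_edges E R2 \<subseteq> insert ?e ?G" by auto
  have rest: "blocked_tensor E P (V - R1) (k(?e := c v)) t
      = (\<Sum>g\<in>bond_indices P ?G. block_at_edge E P ?e R2 (c v) g q * block_opposite E P ?G R3 k g r)" for k
    unfolding l3(4) blocked_tensor_Un[OF graph V(2) part(3)] l3(3) block_at_edge_def block_opposite_def
    using l2 l3(1) t
    by (intro sum.cong refl arg_cong2[where f = "(*)"] blocked_tensor_cong)
      (auto simp: override_on_def)
  have first: "blocked_tensor E P R1 (k(?e := c u)) t = block_at_edge E P ?e R1 (c u) k p" for k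
    unfolding block_at_edge_def using t by (intro blocked_tensor_cong) auto
  note ring = injective_ring_of_tripartite[OF graph peps tri]
  show ?thesis
    unfolding injective_ring.cut_state_def[OF ring] injective_ring.rest1_def[OF ring]
      peps_state_cut_peps[OF graph V(1) e uv(1) v] rest first ..
qed

text \<open>\<open>\<zeta> w\<close> is the matrix at the end \<open>w\<close> of \<open>e\<close>.
  The relation speaks of opened states only and not of regions, so it can be used in any cut. Both
  ways of writing \<open>e\<close> as \<open>{u, v}\<close> are covered, because a later region may
  contain either end.\<close>

definition bond_gauge ::
  "'v set \<Rightarrow> 'v set set \<Rightarrow> ('v \<Rightarrow> nat) \<Rightarrow> 'v peps \<Rightarrow> 'v peps \<Rightarrow> 'v set \<Rightarrow>
     ('v \<Rightarrow> nat \<Rightarrow> nat \<Rightarrow> complex) \<Rightarrow> bool" where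
  "bond_gauge V E d A B e \<zeta> \<longleftrightarrow> bond_dim A e = bond_dim B e \<and>
    (\<forall>u v. e = {u, v} \<longrightarrow>
      (\<forall>y<bond_dim B e. \<forall>y'<bond_dim B e.
        (\<Sum>x<bond_dim A e. \<zeta> u y x * \<zeta> v y' x) = of_bool (y = y')) \<and>
      (\<forall>c. \<forall>t\<in>phys_indices d V. c u < bond_dim A e \<longrightarrow> c v < bond_dim A e \<longrightarrow>
        peps_state V (E - {e}) (cut_peps e c A) t
        = (\<Sum>y<bond_dim B e. \<Sum>y'<bond_dim B e. \<zeta> u y (c u) * \<zeta> v y' (c v) *
            peps_state V (E - {e}) (cut_peps e (c(u := y, v := y')) B) t)))"

lemma bond_gauge_cancel:
  assumes "bond_gauge V E d A B {u, v} \<zeta>" and "y < bond_dim B {u, v}" and "y' < bond_dim B {u, v}"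
  shows "(\<Sum>x<bond_dim A {u, v}. \<zeta> u y x * \<zeta> v y' x) = of_bool (y = y')"
  using assms unfolding bond_gauge_def by blast

lemma bond_gauge_split:
  assumes "bond_gauge V E d A B {u, v} \<zeta>" and "t \<in> phys_indices d V"
    and "c u < bond_dim A {u, v}" and "c v < bond_dim A {u, v}"
  shows "peps_state V (E - {{u, v}}) (cut_peps {u, v} c A) t
    = (\<Sum>y<bond_dim B {u, v}. \<Sum>y'<bond_dim B {u, v}. \<zeta> u y (c u) * \<zeta> v y' (c v) *
        peps_state V (E - {{u, v}}) (cut_peps {u, v} (c(u := y, v := y')) B) t)"
  using assms unfolding bond_gauge_def by blast

lemma bond_gauge_exists:
  assumes graph: "simple_graph V E" and peps: "is_peps E A" "is_peps E B"
    and same: "same_state V E d A B"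
    and tri: "tripartite_injective_mps V E d A e R1 R2 R3" "tripartite_injective_mps V E d B e R1 R2 R3"
  shows "\<exists>\<zeta>. bond_gauge V E d A B e \<zeta>"
proof -
  obtain u v where uv: "e \<in> E" "e = {u, v}" "u \<in> R1" "v \<in> R2" "u \<noteq> v"
    using tripartite_edges(1,2)[OF graph tri(1)] by blast
  have part: "R1 \<union> R2 \<union> R3 = V" "R1 \<inter> R2 = {}" "R1 \<inter> R3 = {}" "R2 \<inter> R3 = {}"
    using tri by (auto simp: tripartite_injective_mps_def)
  let ?F = "\<lambda>P. bond_indices P (leaving_edges E R1 - {e})"
  let ?G = "\<lambda>P. bond_indices P (leaving_edges E R2 - {e})"
  let ?T1 = "\<lambda>P. block_at_edge E P e R1" and ?T2 = "\<lambda>P. block_at_edge E P e R2"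
  let ?T3 = "\<lambda>P. block_opposite E P (leaving_edges E R2 - {e}) R3"
  let ?cut = "\<lambda>P. injective_ring.cut_state (?F P) (?G P) (?T1 P) (?T2 P) (?T3 P)"
  note ringA = injective_ring_of_tripartite[OF graph peps(1) tri(1)]
  note ringB = injective_ring_of_tripartite[OF graph peps(2) tri(2)]
  have cut: "?cut P (c u) (c v) p q r = peps_state V (E - {e}) (cut_peps e c P) t"
    if "P = A \<or> P = B" "\<And>s. s \<in> R1 \<Longrightarrow> t s = p s" "\<And>s. s \<in> R2 \<Longrightarrow> t s = q s" "\<And>s. s \<in> R3 \<Longrightarrow> t s = r s"
    for P c p q r t
    unfolding uv(2)
  proof (rule cut_state_of_tripartite[OF graph _ _ uv(3,4)])
    show "is_peps E P" "tripartite_injective_mps V E d P {u, v} R1 R2 R3"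
      using that(1) peps tri unfolding uv(2) by blast+
  qed (use that in blast)+
  interpret injective_ring_pair "{..<bond_dim A e}" "?F A" "?G A" "{..<bond_dim B e}" "?F B" "?G B"
    "phys_indices d R1" "phys_indices d R2" "phys_indices d R3"
    "?T1 A" "?T2 A" "?T3 A" "?T1 B" "?T2 B" "?T3 B"
  proof (rule injective_ring_pair.intro[OF ringA ringB], unfold_locales)
    fix p q r
    assume pqr: "p \<in> phys_indices d R1" "q \<in> phys_indices d R2" "r \<in> phys_indices d R3"
    define t where "t = override_on (override_on r q R2) p R1"
    have t: "\<And>s. s \<in> R1 \<Longrightarrow> t s = p s" "\<And>s. s \<in> R2 \<Longrightarrow> t s = q s" "\<And>s. s \<in> R3 \<Longrightarrow> t s = r s"
      using part by (auto simp: t_def override_on_def)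
    have "t \<in> phys_indices d V"
      using pqr part(1) by (auto simp: t_def phys_indices_def PiE_iff extensional_def override_on_def)
    then have "peps_state V E A t = peps_state V E B t"
      using same by (simp add: same_state_def)
    moreover have "(\<Sum>x<bond_dim P e. ?cut P x x p q r) = peps_state V E P t" if "P = A \<or> P = B" for P
      unfolding peps_state_remove_edge[OF graph uv(1)]
      using cut[of P t p q r "\<lambda>_. _"] that t by (intro sum.cong refl) blast
    ultimately show "injective_ring.state {..<bond_dim A e} (?F A) (?G A) (?T1 A) (?T2 A) (?T3 A) p q r
        = injective_ring.state {..<bond_dim B e} (?F B) (?G B) (?T1 B) (?T2 B) (?T3 B) p q r"
      by (simp add: injective_ring.state_def[OF ringA] injective_ring.state_def[OF ringB])
  qed
  obtain Z Zi where dim: "bond_dim A e = bond_dim B e"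
    and Z_Zi: "\<And>y y'. y < bond_dim B e \<Longrightarrow> y' < bond_dim B e \<Longrightarrow>
      (\<Sum>x<bond_dim A e. Z y x * Zi x y') = of_bool (y = y')"
    and split: "\<And>x x' p q r. x < bond_dim A e \<Longrightarrow> x' < bond_dim A e \<Longrightarrow>
      p \<in> phys_indices d R1 \<Longrightarrow> q \<in> phys_indices d R2 \<Longrightarrow> r \<in> phys_indices d R3 \<Longrightarrow>
      ?cut A x x' p q r = (\<Sum>y<bond_dim B e. \<Sum>y'<bond_dim B e. Z y x * Zi x' y' * ?cut B y y' p q r)"
    using injective_ring_pair_gauge[OF injective_ring_pair_axioms] by blast
  \<comment> \<open>The end \<open>v\<close> gets the transpose of the inverse, because the matrices
    at both ends have the index of \<open>B\<close> as row index and that of \<open>A\<close> as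
    column index.\<close>
  define \<zeta> where "\<zeta> w = (if w = u then Z else (\<lambda>y x. Zi x y))" for w
  have \<zeta>: "\<zeta> u = Z" "\<zeta> v = (\<lambda>y x. Zi x y)" using uv(5) by (auto simp: \<zeta>_def)
  have split': "peps_state V (E - {e}) (cut_peps e c A) t
      = (\<Sum>y<bond_dim B e. \<Sum>y'<bond_dim B e. \<zeta> u y (c u) * \<zeta> v y' (c v) *
          peps_state V (E - {e}) (cut_peps e (c(u := y, v := y')) B) t)"
    if "t \<in> phys_indices d V" "c u < bond_dim A e" "c v < bond_dim A e" for c t
  proof -
    have mem: "restrict t R1 \<in> phys_indices d R1" "restrict t R2 \<in> phys_indices d R2" "restrict t R3 \<in> phys_indices d R3"
      using that(1) part(1) by (auto simp: phys_indices_def PiE_iff)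
    have cutA: "?cut A (c u) (c v) (restrict t R1) (restrict t R2) (restrict t R3) = peps_state V (E - {e}) (cut_peps e c A) t"
      by (rule cut) auto
    have cutB: "?cut B y y' (restrict t R1) (restrict t R2) (restrict t R3)
        = peps_state V (E - {e}) (cut_peps e (c(u := y, v := y')) B) t" for y y'
      using cut[of B t "restrict t R1" "restrict t R2" "restrict t R3" "c(u := y, v := y')"] uv(5) by simp
    show ?thesis
      using split[OF that(2,3) mem] unfolding cutA cutB \<zeta> .
  qed
  have "bond_gauge V E d A B e \<zeta>"
    unfolding bond_gauge_def
  proof (intro conjI allI impI ballI dim)
    fix a b assume ab: "e = {a, b}"
    then have "(a = u \<and> b = v) \<or> (a = v \<and> b = u)" using uv(2) by (auto simp: doubleton_eq_iff)
    then consider "a = u" "b = v" | "a = v" "b = u" by blast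
    note cases = this
    {
      fix y y' assume y: "y < bond_dim B e" "y' < bond_dim B e"
      show "(\<Sum>x<bond_dim A e. \<zeta> a y x * \<zeta> b y' x) = of_bool (y = y')"
        by (rule cases) (use Z_Zi[OF y] Z_Zi[OF y(2,1)] in \<open>auto simp: \<zeta> mult.commute\<close>)
    next
      fix c t assume t: "t \<in> phys_indices d V" "c a < bond_dim A e" "c b < bond_dim A e"
      show "peps_state V (E - {e}) (cut_peps e c A) t
          = (\<Sum>y<bond_dim B e. \<Sum>y'<bond_dim B e. \<zeta> a y (c a) * \<zeta> b y' (c b) *
              peps_state V (E - {e}) (cut_peps e (c(a := y, b := y')) B) t)"
      proof (rule cases)
        assume [simp]: "a = u" "b = v"
        show ?thesis using split'[of t c] t by simp
      next
        assume [simp]: "a = v" "b = u"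
        show ?thesis using split'[of t c] t uv(5)
          by (subst sum.swap) (simp add: fun_upd_twist mult_ac)
      qed
    }
  qed
  then show ?thesis by blast
qed

text \<open>\<open>B\<close> after the gauge, with \<open>m\<close> the bond dimensions of
  \<open>A\<close>: the candidate that agrees with \<open>A\<close> up to one scalar per site.
  Entries are kept as functions until the final matrices are assembled.\<close>

definition gauge_peps ::
  "'v set set \<Rightarrow> ('v set \<Rightarrow> nat) \<Rightarrow> ('v \<Rightarrow> 'v set \<Rightarrow> nat \<Rightarrow> nat \<Rightarrow> complex) \<Rightarrow> 'v peps \<Rightarrow> 'v peps" where
  "gauge_peps E m z B = \<lparr>bond_dim = m, site_tensor = \<lambda>s i p.
     \<Sum>j\<in>bond_indices B (edges_at E s). site_tensor B s j p * (\<Prod>e\<in>edges_at E s. z s e (j e) (i e))\<rparr>"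

text \<open>The matrix of the cut around \<open>R\<close> is a scalar times the product of the bond
  gauges at the ends inside \<open>R\<close>. That product applied to the block of \<open>B\<close>
  is the block of the gauged \<open>B\<close>, since its interior gauges cancel.\<close>

lemma region_proportional:
  assumes graph: "simple_graph V E" and peps: "is_peps E A" "is_peps E B"
    and same: "same_state V E d A B"
    and gauge: "\<And>e. e \<in> E \<Longrightarrow> bond_gauge V E d A B e (\<lambda>s. z s e)"
    and inj: "injective_region V E d A R" "injective_region V E d A (V - R)" "injective_region V E d B R"
  obtains c where "c \<noteq> 0"
    and "\<And>i p. i \<in> bond_indices A (leaving_edges E R) \<Longrightarrow> p \<in> phys_indices d R \<Longrightarrow>
      blocked_tensor E A R i p = c * blocked_tensor E (gauge_peps E (bond_dim A) z B) R i p"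
proof -
  have R: "R \<subseteq> V" using inj(1) by (simp add: injective_region_def)
  let ?K = "leaving_edges E R"
  have KE: "?K \<subseteq> E" by (auto simp: leaving_edges_def)
  have fin: "finite ?K" using simple_graph_finite_edges[OF graph] KE by (rule finite_subset[rotated])
  note complement = leaving_edges_complement(1)[OF graph R]
  have t: "override_on q p R \<in> phys_indices d V \<and>
      blocked_tensor E P R i (override_on q p R) = blocked_tensor E P R i p \<and>
      blocked_tensor E P (V - R) i (override_on q p R) = blocked_tensor E P (V - R) i q"
    if "p \<in> phys_indices d R" "q \<in> phys_indices d (V - R)" for p q P i
    using phys_indices_override[OF that R] by (auto intro!: blocked_tensor_cong)
  \<comment> \<open>On a bond of the cut, the gauge at the end inside \<open>R\<close> serves as
    \<open>Z\<close>, and the transposed gauge at the end outside as its inverse.\<close>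
  obtain c where c: "c \<noteq> 0"
    "\<And>i p. i \<in> bond_indices A ?K \<Longrightarrow> p \<in> phys_indices d R \<Longrightarrow> blocked_tensor E A R i p
      = c * (\<Sum>j\<in>bond_indices B ?K. (\<Prod>e\<in>?K. z (the_elem (e \<inter> R)) e (j e) (i e)) * blocked_tensor E B R j p)"
  proof (rule cut_gauge_product[where K = ?K and m = "bond_dim A" and n = "bond_dim B"
        and P = "phys_indices d R" and Q = "phys_indices d (V - R)"
        and a = "blocked_tensor E A R" and b = "blocked_tensor E B R"
        and a' = "blocked_tensor E A (V - R)" and b' = "blocked_tensor E B (V - R)"
        and Z = "\<lambda>e. z (the_elem (e \<inter> R)) e" and Zi = "\<lambda>e x y. z (the_elem (e - R)) e y x",
        folded bond_indices_def])
    show "finite ?K" by (rule fin)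
    show "0 < bond_dim A e" "0 < bond_dim B e" if "e \<in> ?K" for e
      using that peps KE by (auto simp: is_peps_def)
    show "left_invertible_on (bond_indices B ?K) (phys_indices d R) (blocked_tensor E B R)"
      "left_invertible_on (bond_indices A ?K) (phys_indices d R) (blocked_tensor E A R)"
      "left_invertible_on (bond_indices A ?K) (phys_indices d (V - R)) (blocked_tensor E A (V - R))"
      using injective_region_left_invertible[OF graph inj(1)] injective_region_left_invertible[OF graph inj(2)]
        injective_region_left_invertible[OF graph inj(3)] by (simp_all add: complement)
    fix p q assume pq: "p \<in> phys_indices d R" "q \<in> phys_indices d (V - R)"
    have "peps_state V E A (override_on q p R) = peps_state V E B (override_on q p R)"
      using same t[OF pq] by (simp add: same_state_def)
    then show "(\<Sum>i\<in>bond_indices A ?K. blocked_tensor E A R i p * blocked_tensor E A (V - R) i q)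
        = (\<Sum>j\<in>bond_indices B ?K. blocked_tensor E B R j p * blocked_tensor E B (V - R) j q)"
      using t[OF pq] by (simp add: peps_state_cut[OF graph R])
  next
    fix e y y' assume e: "e \<in> ?K" and y: "y < bond_dim B e" "y' < bond_dim B e"
    obtain u v where uv: "e = {u, v}" "e \<inter> R = {u}" "e - R = {v}"
      using leaving_edges_ends[OF graph e] by metis
    have "e \<in> E" using e KE by blast
    then have "(\<Sum>x<bond_dim A e. z u e y x * z v e y' x) = of_bool (y = y')"
      using bond_gauge_cancel[OF gauge[of e, unfolded uv(1)]] y unfolding uv(1) by blast
    then show "(\<Sum>x<bond_dim A e. z (the_elem (e \<inter> R)) e y x * z (the_elem (e - R)) e y' x) = of_bool (y = y')"
      unfolding uv(2,3) by simp
  next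
    fix e x x' p q
    assume e: "e \<in> ?K" and x: "x < bond_dim A e" "x' < bond_dim A e"
      and pq: "p \<in> phys_indices d R" "q \<in> phys_indices d (V - R)"
    obtain u v where uv: "e = {u, v}" "u \<in> R" "v \<notin> R" "e \<inter> R = {u}" "e - R = {v}" using leaving_edges_ends[OF graph e] .
    have eE: "{u, v} \<in> E" using e KE uv(1) by blast
    have uv': "u \<noteq> v" using uv by auto
    let ?t = "override_on q p R"
    \<comment> \<open>The default \<open>x'\<close> is arbitrary: only the values at
      \<open>u\<close> and \<open>v\<close> are read.\<close>
    have cut: "(\<Sum>k\<in>bond_indices P (?K - {e}). blocked_tensor E P R (k(e := y)) p * blocked_tensor E P (V - R) (k(e := y')) q)
        = peps_state V (E - {e}) (cut_peps e ((\<lambda>_. x')(u := y, v := y')) P) ?t" for P y y'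
      using t[OF pq] uv' unfolding uv(1) peps_state_cut_peps[OF graph R eE uv(2,3)] by simp
    have "peps_state V (E - {e}) (cut_peps e ((\<lambda>_. x')(u := x, v := x')) A) ?t
        = (\<Sum>y<bond_dim B e. \<Sum>y'<bond_dim B e. z u e y x * z v e y' x' *
          peps_state V (E - {e}) (cut_peps e ((\<lambda>_. x')(u := x, v := x', u := y, v := y')) B) ?t)"
    proof -
      have c: "((\<lambda>_. x')(u := x, v := x')) u = x" "((\<lambda>_. x')(u := x, v := x')) v = x'"
        using uv' by simp_all
      show ?thesis
        using bond_gauge_split[OF gauge[OF eE], of ?t "(\<lambda>_. x')(u := x, v := x')"] t[OF pq] x
        unfolding uv(1) c by blast
    qed
    moreover have "((\<lambda>_. x')(u := x, v := x', u := y, v := y')) = (\<lambda>_. x')(u := y, v := y')" for y y'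
      by auto
    ultimately show "(\<Sum>k\<in>bond_indices A (?K - {e}). blocked_tensor E A R (k(e := x)) p * blocked_tensor E A (V - R) (k(e := x')) q)
        = (\<Sum>y<bond_dim B e. \<Sum>y'<bond_dim B e. z (the_elem (e \<inter> R)) e y x * z (the_elem (e - R)) e y' x' *
          (\<Sum>k\<in>bond_indices B (?K - {e}). blocked_tensor E B R (k(e := y)) p * blocked_tensor E B (V - R) (k(e := y')) q))"
      unfolding cut uv(4,5) by simp
  qed blast
  have "blocked_tensor E (gauge_peps E (bond_dim A) z B) R i p
      = (\<Sum>j\<in>bond_indices B ?K. blocked_tensor E B R j p * (\<Prod>e\<in>?K. boundary_gauge z R e (j e) (i e)))"
    if "i \<in> bond_indices A ?K" for i p
  proof (rule blocked_tensor_gauge[OF graph R])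
    show "(\<Sum>x<bond_dim (gauge_peps E (bond_dim A) z B) {u, v}. z u {u, v} y x * z v {u, v} y' x) = of_bool (y = y')"
      if "{u, v} \<in> E" "y < bond_dim B {u, v}" "y' < bond_dim B {u, v}" for u v y y'
      using bond_gauge_cancel[OF gauge[OF that(1)] that(2,3)] by (simp add: gauge_peps_def)
    show "i e < bond_dim (gauge_peps E (bond_dim A) z B) e" if "e \<in> ?K" for e
      using \<open>i \<in> _\<close> that by (auto simp: gauge_peps_def bond_indices_def PiE_iff)
  qed (simp add: gauge_peps_def)
  with c show thesis by (intro that[OF c(1)]) (simp add: boundary_gauge_def mult.commute)
qed

lemma site_gauge:
  assumes graph: "simple_graph V E" and peps: "is_peps E A" "is_peps E B"
    and same: "same_state V E d A B"
    and gauge: "\<And>e. e \<in> E \<Longrightarrow> bond_gauge V E d A B e (\<lambda>s. z s e)"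
    and pairs: "injective_pair_at V E d A s R" "injective_pair_at V E d B s R"
  shows "\<exists>c. c \<noteq> 0 \<and> (\<forall>i\<in>bond_indices A (edges_at E s). \<forall>q<d s.
    site_tensor A s i q = c * site_tensor (gauge_peps E (bond_dim A) z B) s i q)"
proof -
  let ?C = "gauge_peps E (bond_dim A) z B"
  have s: "s \<notin> R" "insert s R \<subseteq> V"
    and injA: "injective_region V E d A R" "injective_region V E d A (V - R)"
      "injective_region V E d A (insert s R)" "injective_region V E d A (V - insert s R)"
    and injB: "injective_region V E d B R" "injective_region V E d B (insert s R)"
    using pairs unfolding injective_pair_at_def injective_region_def by blast+
  obtain c1 where c1: "c1 \<noteq> 0" "\<And>i p. i \<in> bond_indices A (leaving_edges E R) \<Longrightarrow> p \<in> phys_indices d R \<Longrightarrow>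
      blocked_tensor E A R i p = c1 * blocked_tensor E ?C R i p"
    using region_proportional[OF graph peps same gauge injA(1,2) injB(1)] by blast
  obtain c2 where c2: "c2 \<noteq> 0" "\<And>i p. i \<in> bond_indices A (leaving_edges E (insert s R)) \<Longrightarrow>
      p \<in> phys_indices d (insert s R) \<Longrightarrow>
      blocked_tensor E A (insert s R) i p = c2 * blocked_tensor E ?C (insert s R) i p"
    using region_proportional[OF graph peps same gauge injA(3,4) injB(2)] by blast
  have "site_tensor A s i q = c2 / c1 * site_tensor ?C s i q"
    if "i \<in> bond_indices A (edges_at E s)" "q < d s" for i q
    using site_tensor_proportional[OF graph peps(1) s _ injective_region_left_invertible[OF graph injA(1)] c1 c2(2) that]
    by (simp add: gauge_peps_def)
  then show ?thesis using c1(1) c2(1) by (intro exI[of _ "c2 / c1"]) simp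
qed

section \<open>Scalars and existence\<close>

text \<open>If the state vanished, cancelling the independent block of \<open>R\<close> would make
  the complementary block zero, although that block is independent too and its index set is
  nonempty.\<close>

lemma peps_state_nonzero:
  assumes graph: "simple_graph V E" and peps: "is_peps E P"
    and inj: "injective_region V E d P R" "injective_region V E d P (V - R)"
  shows "\<exists>t\<in>phys_indices d V. peps_state V E P t \<noteq> 0"
proof (rule ccontr)
  assume "\<not> ?thesis"
  then have zero: "peps_state V E P t = 0" if "t \<in> phys_indices d V" for t using that by blast
  have R: "R \<subseteq> V" using inj(1) by (simp add: injective_region_def)
  let ?K = "leaving_edges E R"
  have fin: "finite (bond_indices P ?K)"
    using simple_graph_finite_edges[OF graph] by (simp add: leaving_edges_def)
  obtain i where i: "i \<in> bond_indices P ?K"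
    using bond_indices_nonempty[OF peps, of ?K] unfolding leaving_edges_def by blast
  have "left_invertible_on (bond_indices P ?K) (phys_indices d (V - R)) (blocked_tensor E P (V - R))"
    using injective_region_left_invertible[OF graph inj(2)] by (simp add: leaving_edges_complement(1)[OF graph R])
  then obtain q where q: "q \<in> phys_indices d (V - R)" "blocked_tensor E P (V - R) i q \<noteq> 0"
    using left_invertible_on_nonzero[OF _ i] by blast
  have "blocked_tensor E P (V - R) i q = 0"
  proof (rule left_invertible_on_cancel[OF injective_region_left_invertible[OF graph inj(1)] fin i])
    fix p assume p: "p \<in> phys_indices d R"
    let ?t = "override_on q p R"
    have "peps_state V E P ?t = 0"
      by (rule zero, rule phys_indices_override[OF p q(1) R])
    then have "(\<Sum>i\<in>bond_indices P ?K. blocked_tensor E P R i ?t * blocked_tensor E P (V - R) i ?t) = 0"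
      unfolding peps_state_cut[OF graph R] .
    moreover have "blocked_tensor E P R i ?t = blocked_tensor E P R i p"
      "blocked_tensor E P (V - R) i ?t = blocked_tensor E P (V - R) i q" for i
      by (rule blocked_tensor_cong; simp)+
    ultimately show "(\<Sum>i\<in>bond_indices P ?K. blocked_tensor E P (V - R) i q * blocked_tensor E P R i p)
        = (\<Sum>i\<in>bond_indices P ?K. 0 * blocked_tensor E P R i p)"
      by (simp add: mult.commute)
  qed
  with q(2) show False by simp
qed

text \<open>A multiplicative flow: \<open>t a * t b = 1\<close> on an edge is antisymmetry, and the
  product at a vertex is the divergence. A flow of strength \<open>c\<close> is sent from
  \<open>u\<close> to \<open>v\<close> along the path.\<close>

lemma path_flow:
  fixes c :: complex
  assumes graph: "simple_graph V E" and path: "(u, v) \<in> {(x, y). {x, y} \<in> E}\<^sup>*" and c: "c \<noteq> 0"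
  shows "\<exists>t. (\<forall>a b. {a, b} \<in> E \<longrightarrow> t a {a, b} * t b {a, b} = 1) \<and>
    (\<forall>w. (\<Prod>e\<in>edges_at E w. t w e) = (if w = u then c else 1) * (if w = v then inverse c else 1))"
  using path
proof (induction rule: rtrancl_induct)
  case base
  show ?case using c by (intro exI[of _ "\<lambda>_ _. 1"]) simp
next
  case (step y z)
  then obtain t where t: "\<And>a b. {a, b} \<in> E \<Longrightarrow> t a {a, b} * t b {a, b} = 1"
    "\<And>w. (\<Prod>e\<in>edges_at E w. t w e) = (if w = u then c else 1) * (if w = y then inverse c else 1)"
    by blast
  have yz: "{y, z} \<in> E" using step by simp
  then have "card {y, z} = 2" using graph unfolding simple_graph_def by blast
  then have ne: "y \<noteq> z" by auto
  \<comment> \<open>One more edge with flow \<open>c\<close> moves the sink from \<open>y\<close> to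
    \<open>z\<close>.\<close>
  define g where "g w e = (if e = {y, z} then if w = y then c else if w = z then inverse c else 1 else 1)"
    for w e
  have fin: "finite (edges_at E w)" for w
    using simple_graph_finite_edges[OF graph] by (auto simp: edges_at_def)
  have "(\<Prod>e\<in>edges_at E w. g w e) = (if w = y then c else if w = z then inverse c else 1)" for w
    unfolding g_def using fin yz by (simp add: prod.delta edges_at_def)
  then have "(\<Prod>e\<in>edges_at E w. t w e * g w e)
      = (if w = u then c else 1) * (if w = z then inverse c else 1)" for w
    using t(2) ne c by (simp add: prod.distrib)
  moreover have "(t a {a, b} * g a {a, b}) * (t b {a, b} * g b {a, b}) = 1" if "{a, b} \<in> E" for a b
  proof -
    have "g a {a, b} * g b {a, b} = 1"
      using ne c by (auto simp: g_def doubleton_eq_iff)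
    then show ?thesis using t(1)[OF that] by (simp add: mult_ac)
  qed
  ultimately show ?case by (intro exI[of _ "\<lambda>w e. t w e * g w e"]) simp
qed

text \<open>Each \<open>c s\<close> is sent from \<open>s\<close> to a common root \<open>r\<close>,
  and the flows are multiplied. The sink at \<open>r\<close> collects the inverse of the product of
  all scalars, which is 1.\<close>

lemma vertex_scalars_flow:
  fixes c :: "'v \<Rightarrow> complex"
  assumes graph: "simple_graph V E" and conn: "connected_graph V E"
    and c: "\<And>s. s \<in> V \<Longrightarrow> c s \<noteq> 0" and c1: "(\<Prod>s\<in>V. c s) = 1"
  obtains t where "\<And>a b. {a, b} \<in> E \<Longrightarrow> t a {a, b} * t b {a, b} = 1"
    and "\<And>s. s \<in> V \<Longrightarrow> (\<Prod>e\<in>edges_at E s. t s e) = c s"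
proof (cases "V = {}")
  case True
  then have "E = {}" using graph by (force simp: simple_graph_def)
  with True show thesis by (intro that[of "\<lambda>_ _. 1"]) auto
next
  case False
  then obtain r where r: "r \<in> V" by blast
  have fin: "finite V" using graph by (simp add: simple_graph_def)
  have "\<exists>t. (\<forall>a b. {a, b} \<in> E \<longrightarrow> t a {a, b} * t b {a, b} = 1) \<and>
      (\<forall>w. (\<Prod>e\<in>edges_at E w. t w e) = (if w = s then c s else 1) * (if w = r then inverse (c s) else 1))"
    if s: "s \<in> V" for s
  proof (rule path_flow[OF graph _ c[OF s]])
    show "(s, r) \<in> {(x, y). {x, y} \<in> E}\<^sup>*" using conn s r unfolding connected_graph_def by blast
  qed
  then obtain t where t: "\<And>s a b. s \<in> V \<Longrightarrow> {a, b} \<in> E \<Longrightarrow> t s a {a, b} * t s b {a, b} = 1"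
    "\<And>s w. s \<in> V \<Longrightarrow> (\<Prod>e\<in>edges_at E w. t s w e)
      = (if w = s then c s else 1) * (if w = r then inverse (c s) else 1)"
    by metis
  show thesis
  proof (rule that[of "\<lambda>w e. \<Prod>s\<in>V. t s w e"])
    show "(\<Prod>s\<in>V. t s a {a, b}) * (\<Prod>s\<in>V. t s b {a, b}) = 1" if "{a, b} \<in> E" for a b
      using t(1)[OF _ that] by (simp flip: prod.distrib)
    fix w assume w: "w \<in> V"
    have "(\<Prod>e\<in>edges_at E w. \<Prod>s\<in>V. t s w e) = (\<Prod>s\<in>V. (if w = s then c s else 1) * (if w = r then inverse (c s) else 1))"
      using t(2) by (subst prod.swap) simp
    also have "\<dots> = c w * (if w = r then inverse (\<Prod>s\<in>V. c s) else 1)"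
      using fin w by (simp add: prod.distrib prod.delta' prod_inversef[symmetric] comp_def)
    finally show "(\<Prod>e\<in>edges_at E w. \<Prod>s\<in>V. t s w e) = c w" using c1 by simp
  qed
qed

text \<open>The block \<open>V\<close> has no leaving edges, so no gauge factor survives.\<close>

lemma peps_state_gauge_peps:
  assumes graph: "simple_graph V E"
    and gauge: "\<And>e. e \<in> E \<Longrightarrow> bond_gauge V E d A B e (\<lambda>s. z s e)"
  shows "peps_state V E (gauge_peps E (bond_dim A) z B) t = peps_state V E B t"
proof -
  let ?C = "gauge_peps E (bond_dim A) z B"
  have "leaving_edges E V = {}" using graph by (auto simp: leaving_edges_def simple_graph_def)
  moreover have "blocked_tensor E ?C V (\<lambda>_. undefined) t
      = (\<Sum>j\<in>bond_indices B (leaving_edges E V). blocked_tensor E B V j t *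
          (\<Prod>e\<in>leaving_edges E V. boundary_gauge z V e (j e) undefined))"
  proof (rule blocked_tensor_gauge[OF graph order.refl])
    show "(\<Sum>x<bond_dim ?C {u, v}. z u {u, v} y x * z v {u, v} y' x) = of_bool (y = y')"
      if "{u, v} \<in> E" "y < bond_dim B {u, v}" "y' < bond_dim B {u, v}" for u v y y'
      using bond_gauge_cancel[OF gauge[OF that(1)] that(2,3)] by (simp add: gauge_peps_def)
  qed (use \<open>leaving_edges E V = {}\<close> in \<open>simp_all add: gauge_peps_def\<close>)
  ultimately show ?thesis
    by (simp add: peps_state_eq_blocked_tensor[OF graph, where i = "\<lambda>_. undefined"] bond_indices_def)
qed

lemma gauge_transformation_exists:
  fixes A B :: "'v peps"
  assumes graph: "simple_graph V E" and conn: "connected_graph V E"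
    and peps: "is_peps E A" "is_peps E B" and same: "same_state V E d A B"
    and tripartite: "\<forall>e\<in>E. \<exists>R1 R2 R3.
      tripartite_injective_mps V E d A e R1 R2 R3 \<and> tripartite_injective_mps V E d B e R1 R2 R3"
    and pairs: "\<forall>s\<in>V. \<exists>R. injective_pair_at V E d A s R \<and> injective_pair_at V E d B s R"
  shows "\<exists>Z. gauge_transformation V E d A B Z"
proof -
  have "\<forall>e\<in>E. \<exists>\<zeta>. bond_gauge V E d A B e \<zeta>"
    using bond_gauge_exists[OF graph peps same] tripartite by blast
  then obtain z' where z': "\<And>e. e \<in> E \<Longrightarrow> bond_gauge V E d A B e (z' e)" by metis
  define z where "z s e = z' e s" for s e
  have gauge: "bond_gauge V E d A B e (\<lambda>s. z s e)" if "e \<in> E" for e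
    using z'[OF that] by (simp add: z_def)
  have dim: "bond_dim A e = bond_dim B e" if "e \<in> E" for e
    using gauge[OF that] by (simp add: bond_gauge_def)
  let ?C = "gauge_peps E (bond_dim A) z B"
  have "\<forall>s\<in>V. \<exists>c. c \<noteq> 0 \<and> (\<forall>i\<in>bond_indices A (edges_at E s). \<forall>q<d s.
      site_tensor A s i q = c * site_tensor ?C s i q)"
    using site_gauge[OF graph peps same gauge] pairs by blast
  then obtain c where c: "\<And>s. s \<in> V \<Longrightarrow> c s \<noteq> 0"
    "\<And>s i q. s \<in> V \<Longrightarrow> i \<in> bond_indices A (edges_at E s) \<Longrightarrow> q < d s \<Longrightarrow>
      site_tensor A s i q = c s * site_tensor ?C s i q"
    by metis
  \<comment> \<open>Pulling out the scalars leaves the state of the gauged \<open>B\<close>, which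
    is the state of \<open>B\<close> and hence that of \<open>A\<close>.\<close>
  have state: "peps_state V E A t = (\<Prod>s\<in>V. c s) * peps_state V E A t" if t: "t \<in> phys_indices d V" for t
  proof -
    have "site_tensor A s (restrict k (edges_at E s)) (t s)
        = c s * site_tensor ?C s (restrict k (edges_at E s)) (t s)"
      if "k \<in> bond_indices A E" "s \<in> V" for k s
      using that t by (intro c(2)) (auto simp: bond_indices_def phys_indices_def PiE_iff edges_at_def)
    then have "(\<Prod>s\<in>V. site_tensor A s (restrict k (edges_at E s)) (t s))
        = (\<Prod>s\<in>V. c s) * (\<Prod>s\<in>V. site_tensor ?C s (restrict k (edges_at E s)) (t s))"
      if "k \<in> bond_indices A E" for k
      using that unfolding prod.distrib[symmetric] by (intro prod.cong refl) blast
    moreover have "bond_indices ?C E = bond_indices A E" by (simp add: bond_indices_def gauge_peps_def)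
    ultimately have "peps_state V E A t = (\<Prod>s\<in>V. c s) * peps_state V E ?C t"
      unfolding peps_state_def by (simp add: sum_distrib_left)
    also have "peps_state V E ?C t = peps_state V E A t"
      using peps_state_gauge_peps[OF graph gauge] same t by (simp add: same_state_def)
    finally show ?thesis .
  qed
  have c1: "(\<Prod>s\<in>V. c s) = 1"
  proof (cases "V = {}")
    case False
    then obtain s where "s \<in> V" by blast
    then obtain R where "injective_pair_at V E d A s R" using pairs by blast
    then obtain t where "t \<in> phys_indices d V" "peps_state V E A t \<noteq> 0"
      using peps_state_nonzero[OF graph peps(1)] unfolding injective_pair_at_def by blast
    then show ?thesis using state[of t] by simp
  qed simp
  obtain t where t: "\<And>a b. {a, b} \<in> E \<Longrightarrow> t a {a, b} * t b {a, b} = 1"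
    "\<And>s. s \<in> V \<Longrightarrow> (\<Prod>e\<in>edges_at E s. t s e) = c s"
    using vertex_scalars_flow[OF graph conn c(1) c1] by blast
  \<comment> \<open>The factors \<open>t\<close> multiply to \<open>c s\<close> at each site and to
    1 on each edge: they absorb the site scalars and preserve the cancellation on the bonds.\<close>
  define Z where "Z s e = mat (bond_dim B e) (bond_dim A e) (\<lambda>(y, x). t s e * z s e y x)" for s e
  have carrier: "Z s e \<in> carrier_mat (bond_dim B e) (bond_dim A e)" for s e by (simp add: Z_def)
  have inverse: "Z u {u, v} * transpose_mat (Z v {u, v}) = 1\<^sub>m (bond_dim B {u, v})" if "{u, v} \<in> E" for u v
  proof (rule eq_matI)
    fix y y' assume "y < dim_row (1\<^sub>m (bond_dim B {u, v}) :: complex mat)" "y' < dim_col (1\<^sub>m (bond_dim B {u, v}) :: complex mat)"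
    then have y: "y < bond_dim B {u, v}" "y' < bond_dim B {u, v}" by simp_all
    have "(Z u {u, v} * transpose_mat (Z v {u, v})) $$ (y, y')
        = (t u {u, v} * t v {u, v}) * (\<Sum>x<bond_dim A {u, v}. z u {u, v} y x * z v {u, v} y' x)"
      using y by (simp add: Z_def scalar_prod_def sum_distrib_left lessThan_atLeast0 mult_ac)
    then show "(Z u {u, v} * transpose_mat (Z v {u, v})) $$ (y, y') = 1\<^sub>m (bond_dim B {u, v}) $$ (y, y')"
      using bond_gauge_cancel[OF gauge[OF that] y] t(1)[OF that] y by simp
  qed (simp_all add: Z_def)
  have invertible: "invertible_mat (Z s e)" if "e \<in> edges_at E s" for s e
  proof -
    have e: "e \<in> E" "s \<in> e" using that by (auto simp: edges_at_def)
    then obtain v where v: "e = {s, v}"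
      using simple_graph_edgeE[OF graph e(1)] by (metis insertE insert_commute singletonD)
    have carr: "Z s e \<in> carrier_mat (bond_dim B e) (bond_dim B e)"
      "transpose_mat (Z v e) \<in> carrier_mat (bond_dim B e) (bond_dim B e)"
      using carrier[of _ e] dim[OF e(1)] by simp_all
    have "Z s e * transpose_mat (Z v e) = 1\<^sub>m (bond_dim B e)" using inverse e(1) v by blast
    then show ?thesis
      using mat_mult_left_right_inverse[OF carr] carr unfolding invertible_mat_def inverts_mat_def by auto
  qed
  have site: "site_tensor A s i p = apply_virtual E B s (Z s) i p"
    if s: "s \<in> V" and i: "i \<in> bond_indices A (edges_at E s)" and p: "p < d s" for s i p
  proof -
    have "site_tensor A s i p = c s * (\<Sum>j\<in>bond_indices B (edges_at E s).
        site_tensor B s j p * (\<Prod>e\<in>edges_at E s. z s e (j e) (i e)))"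
      using c(2)[OF s i p] by (simp add: gauge_peps_def)
    also have "\<dots> = (\<Sum>j\<in>bond_indices B (edges_at E s).
        site_tensor B s j p * (\<Prod>e\<in>edges_at E s. t s e * z s e (j e) (i e)))"
      using t(2)[OF s] by (simp add: prod.distrib sum_distrib_left mult_ac)
    also have "\<dots> = (\<Sum>j\<in>bond_indices B (edges_at E s).
        site_tensor B s j p * (\<Prod>e\<in>edges_at E s. Z s e $$ (j e, i e)))"
      using i by (intro sum.cong prod.cong refl arg_cong2[where f = "(*)"])
        (auto simp: Z_def bond_indices_def PiE_iff)
    finally show ?thesis by (simp add: apply_virtual_def)
  qed
  have "gauge_transformation V E d A B Z"
    unfolding gauge_transformation_def inverts_mat_def
    using carrier invertible inverse site by (auto simp: Z_def)
  then show ?thesis by blast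
qed

section \<open>Uniqueness\<close>

text \<open>All coordinates except \<open>e0\<close> are frozen where \<open>\<beta>\<close> is
  nonzero. The constant is the ratio of the two frozen products, and it cannot be 0 because
  \<open>\<beta> e0\<close> has a nonzero entry.\<close>

lemma prod_eq_imp_factor_proportional:
  fixes \<alpha> \<beta> :: "'e \<Rightarrow> nat \<Rightarrow> nat \<Rightarrow> complex"
  assumes "finite K" and e0: "e0 \<in> K"
    and eq: "\<And>i j. i \<in> PiE K S \<Longrightarrow> j \<in> PiE K T \<Longrightarrow>
      (\<Prod>e\<in>K. \<alpha> e (j e) (i e)) = (\<Prod>e\<in>K. \<beta> e (j e) (i e))"
    and nz: "\<And>e. e \<in> K \<Longrightarrow> \<exists>x\<in>S e. \<exists>y\<in>T e. \<beta> e y x \<noteq> 0"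
  shows "\<exists>c. c \<noteq> 0 \<and> (\<forall>x\<in>S e0. \<forall>y\<in>T e0. \<beta> e0 y x = c * \<alpha> e0 y x)"
proof -
  obtain x0 y0 where 0: "\<And>e. e \<in> K \<Longrightarrow> x0 e \<in> S e \<and> y0 e \<in> T e \<and> \<beta> e (y0 e) (x0 e) \<noteq> 0"
    using nz by metis
  let ?a = "\<Prod>e\<in>K - {e0}. \<alpha> e (y0 e) (x0 e)" and ?b = "\<Prod>e\<in>K - {e0}. \<beta> e (y0 e) (x0 e)"
  have b: "?b \<noteq> 0" using 0 assms(1) by simp
  have proportional: "\<alpha> e0 y x * ?a = \<beta> e0 y x * ?b" if "x \<in> S e0" "y \<in> T e0" for x y
  proof -
    let ?i = "restrict (x0(e0 := x)) K" and ?j = "restrict (y0(e0 := y)) K"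
    have ij: "?i \<in> PiE K S" "?j \<in> PiE K T" using 0 that by auto
    have split: "(\<Prod>e\<in>K. \<gamma> e (?j e) (?i e)) = \<gamma> e0 y x * (\<Prod>e\<in>K - {e0}. \<gamma> e (y0 e) (x0 e))"
      for \<gamma> :: "'e \<Rightarrow> nat \<Rightarrow> nat \<Rightarrow> complex"
      unfolding prod.remove[OF assms(1) e0] using e0 by (auto intro!: arg_cong2[where f = "(*)"] prod.cong)
    show ?thesis using eq[OF ij] unfolding split .
  qed
  have "\<beta> e0 y x = (?a / ?b) * \<alpha> e0 y x" if "x \<in> S e0" "y \<in> T e0" for x y
    using proportional[OF that] b by (simp add: field_simps)
  moreover from this[of "x0 e0" "y0 e0"] have "?a / ?b \<noteq> 0" using 0[OF e0] by auto
  ultimately show ?thesis by blast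
qed

lemma gauge_transformation_cancel:
  assumes gauge: "gauge_transformation V E d A B Z" and graph: "simple_graph V E"
    and uv: "{u, v} \<in> E" and y: "y < bond_dim B {u, v}" "y' < bond_dim B {u, v}"
  shows "(\<Sum>x<bond_dim A {u, v}. Z u {u, v} $$ (y, x) * Z v {u, v} $$ (y', x)) = of_bool (y = y')"
proof -
  have V: "u \<in> V" "v \<in> V" using graph uv by (auto simp: simple_graph_def)
  have at: "{u, v} \<in> edges_at E u" "{u, v} \<in> edges_at E v" using uv by (auto simp: edges_at_def)
  have carr: "Z u {u, v} \<in> carrier_mat (bond_dim B {u, v}) (bond_dim A {u, v})"
    "Z v {u, v} \<in> carrier_mat (bond_dim B {u, v}) (bond_dim A {u, v})"
    using gauge V at unfolding gauge_transformation_def by blast+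
  have "inverts_mat (Z u {u, v}) (transpose_mat (Z v {u, v}))"
    using gauge uv unfolding gauge_transformation_def by blast
  then have "Z u {u, v} * transpose_mat (Z v {u, v}) = 1\<^sub>m (bond_dim B {u, v})"
    using carr by (simp add: inverts_mat_def)
  then have "(Z u {u, v} * transpose_mat (Z v {u, v})) $$ (y, y') = of_bool (y = y')"
    using y by simp
  then show ?thesis
    using carr y by (simp add: scalar_prod_def lessThan_atLeast0)
qed

lemma gauge_transformation_unique:
  assumes graph: "simple_graph V E" and peps: "is_peps E A" "is_peps E B"
    and gauge: "gauge_transformation V E d A B Z" "gauge_transformation V E d A B Z'"
    and inj: "injective_region V E d B R"
    and e0: "e0 \<in> leaving_edges E R" "s \<in> R" "s \<in> e0"
  shows "\<exists>c. c \<noteq> 0 \<and> Z' s e0 = c \<cdot>\<^sub>m Z s e0"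
proof -
  let ?K = "leaving_edges E R"
  have R: "R \<subseteq> V" using inj by (simp add: injective_region_def)
  have fin: "finite ?K" using simple_graph_finite_edges[OF graph] by (auto simp: leaving_edges_def)
  define \<zeta> where "\<zeta> Z s e y x = Z s e $$ (y, x)" for Z :: "'a \<Rightarrow> 'a set \<Rightarrow> complex mat" and s e y x
  have blocked: "blocked_tensor E A R i p
      = (\<Sum>j\<in>bond_indices B ?K. (\<Prod>e\<in>?K. boundary_gauge (\<zeta> Z) R e (j e) (i e)) * blocked_tensor E B R j p)"
    if gauge: "gauge_transformation V E d A B Z" and i: "i \<in> bond_indices A ?K" and p: "p \<in> phys_indices d R"
    for Z i p
  proof -
    have "blocked_tensor E A R i p
        = (\<Sum>j\<in>bond_indices B ?K. blocked_tensor E B R j p * (\<Prod>e\<in>?K. boundary_gauge (\<zeta> Z) R e (j e) (i e)))"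
    proof (rule blocked_tensor_gauge[OF graph R])
      show "(\<Sum>x<bond_dim A {u, v}. \<zeta> Z u {u, v} y x * \<zeta> Z v {u, v} y' x) = of_bool (y = y')"
        if "{u, v} \<in> E" "y < bond_dim B {u, v}" "y' < bond_dim B {u, v}" for u v y y'
        using gauge_transformation_cancel[OF gauge graph that] by (simp add: \<zeta>_def)
      fix s i assume s: "s \<in> R" and i: "i \<in> bond_indices A (edges_at E s)"
      have "s \<in> V" "p s < d s" using s R p by (auto simp: phys_indices_def PiE_iff)
      then show "site_tensor A s i (p s)
          = (\<Sum>j\<in>bond_indices B (edges_at E s). site_tensor B s j (p s) * (\<Prod>e\<in>edges_at E s. \<zeta> Z s e (j e) (i e)))"
        using gauge i unfolding gauge_transformation_def apply_virtual_def \<zeta>_def by blast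
    next
      show "i e < bond_dim A e" if "e \<in> ?K" for e
        using i that by (auto simp: bond_indices_def PiE_iff)
    qed
    then show ?thesis by (simp add: mult.commute)
  qed
  have s: "s \<in> V" "e0 \<in> edges_at E s" using e0 R by (auto simp: edges_at_def leaving_edges_def)
  have end0: "the_elem (e0 \<inter> R) = s"
  proof -
    have "e0 \<inter> R = {s}"
      using e0 simple_graph_edge_cases[OF graph, of e0 s] by (fastforce simp: leaving_edges_def)
    then show ?thesis by simp
  qed
  have "\<exists>c. c \<noteq> 0 \<and> (\<forall>x\<in>{..<bond_dim A e0}. \<forall>y\<in>{..<bond_dim B e0}.
      boundary_gauge (\<zeta> Z') R e0 y x = c * boundary_gauge (\<zeta> Z) R e0 y x)"
  proof (rule prod_eq_imp_factor_proportional[OF fin e0(1)])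
    fix i j assume i: "i \<in> (\<Pi>\<^sub>E e\<in>?K. {..<bond_dim A e})" and j: "j \<in> (\<Pi>\<^sub>E e\<in>?K. {..<bond_dim B e})"
    show "(\<Prod>e\<in>?K. boundary_gauge (\<zeta> Z) R e (j e) (i e)) = (\<Prod>e\<in>?K. boundary_gauge (\<zeta> Z') R e (j e) (i e))"
    proof (rule left_invertible_on_cancel[OF injective_region_left_invertible[OF graph inj],
          where i = j and x = "\<lambda>j. \<Prod>e\<in>?K. boundary_gauge (\<zeta> Z) R e (j e) (i e)"
            and y = "\<lambda>j. \<Prod>e\<in>?K. boundary_gauge (\<zeta> Z') R e (j e) (i e)"])
      show "finite (bond_indices B ?K)" using fin by simp
      show "j \<in> bond_indices B ?K" using j by (simp add: bond_indices_def)
      fix p assume p: "p \<in> phys_indices d R"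
      have "i \<in> bond_indices A ?K" using i by (simp add: bond_indices_def)
      then show "(\<Sum>j\<in>bond_indices B ?K. (\<Prod>e\<in>?K. boundary_gauge (\<zeta> Z) R e (j e) (i e)) * blocked_tensor E B R j p)
          = (\<Sum>j\<in>bond_indices B ?K. (\<Prod>e\<in>?K. boundary_gauge (\<zeta> Z') R e (j e) (i e)) * blocked_tensor E B R j p)"
        using blocked[OF gauge(1) _ p] blocked[OF gauge(2) _ p] by simp
    qed
  next
    fix e assume e: "e \<in> ?K"
    then have eE: "e \<in> E" by (simp add: leaving_edges_def)
    obtain u v where uv: "e = {u, v}" "e \<inter> R = {u}"
      using leaving_edges_ends[OF graph e] by metis
    then have bg: "boundary_gauge (\<zeta> Z') R e = \<zeta> Z' u e" by (simp add: boundary_gauge_def)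
    have pos: "0 < bond_dim B e" using peps eE by (simp add: is_peps_def)
    \<comment> \<open>A vanishing matrix would contradict the \<open>(0, 0)\<close> entry of the
      cancellation identity, which exists because bond dimensions are positive.\<close>
    show "\<exists>x\<in>{..<bond_dim A e}. \<exists>y\<in>{..<bond_dim B e}. boundary_gauge (\<zeta> Z') R e y x \<noteq> 0"
    proof (rule ccontr)
      assume "\<not> ?thesis"
      then have "(\<Sum>x<bond_dim A e. Z' u e $$ (0, x) * Z' v e $$ (0, x)) = 0"
        using pos unfolding bg \<zeta>_def by (intro sum.neutral) auto
      then show False
        using gauge_transformation_cancel[OF gauge(2) graph, of u v 0 0] eE uv(1) pos by simp
    qed
  qed
  then obtain c where c: "c \<noteq> 0" "\<And>x y. x < bond_dim A e0 \<Longrightarrow> y < bond_dim B e0 \<Longrightarrow> Z' s e0 $$ (y, x) = c * Z s e0 $$ (y, x)"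
    unfolding boundary_gauge_def end0 \<zeta>_def by auto
  have "Z s e0 \<in> carrier_mat (bond_dim B e0) (bond_dim A e0)" "Z' s e0 \<in> carrier_mat (bond_dim B e0) (bond_dim A e0)"
    using gauge s unfolding gauge_transformation_def by blast+
  then have "Z' s e0 = c \<cdot>\<^sub>m Z s e0" using c(2) by (intro eq_matI) auto
  with c(1) show ?thesis by blast
qed

theorem theorem2p10:
  fixes V :: "'v set" and E :: "'v set set" and d :: "'v \<Rightarrow> nat" and A B :: "'v peps"
  assumes "simple_graph V E" and "connected_graph V E"
    and "is_peps E A" and "is_peps E B"
    and "normal_peps V E d A" and "normal_peps V E d B"
    and "same_state V E d A B"
    and tripartite: "\<forall>e\<in>E. \<exists>R1 R2 R3.
      tripartite_injective_mps V E d A e R1 R2 R3 \<and> tripartite_injective_mps V E d B e R1 R2 R3"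
    and pairs: "\<forall>s\<in>V. \<exists>R. injective_pair_at V E d A s R \<and> injective_pair_at V E d B s R"
  shows "(\<exists>Z. gauge_transformation V E d A B Z) \<and>
    (\<forall>Z Z'. gauge_transformation V E d A B Z \<and> gauge_transformation V E d A B Z' \<longrightarrow>
      (\<forall>s\<in>V. \<forall>e\<in>edges_at E s. \<exists>c. c \<noteq> 0 \<and> Z' s e = c \<cdot>\<^sub>m Z s e))"
proof (intro conjI allI impI ballI)
  show "\<exists>Z. gauge_transformation V E d A B Z"
    by (rule gauge_transformation_exists) fact+
next
  fix Z Z' s e
  assume Z: "gauge_transformation V E d A B Z \<and> gauge_transformation V E d A B Z'"
    and e: "e \<in> edges_at E s"
  have "e \<in> E" "s \<in> e" using e by (auto simp: edges_at_def)
  \<comment> \<open>The tripartition serves again, now as a source of injective regions: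
    \<open>e\<close> leaves both \<open>R1\<close> and \<open>R2\<close>, and one of them contains
    \<open>s\<close>.\<close>
  then obtain R1 R2 R3 where tri: "tripartite_injective_mps V E d B e R1 R2 R3"
    using tripartite by blast
  have inj: "injective_region V E d B R1" "injective_region V E d B R2"
    using tri unfolding tripartite_injective_mps_def by blast+
  note edges = tripartite_edges(2,3,4)[OF assms(1) tri]
  consider "s \<in> R1" | "s \<in> R2" using edges(1) \<open>s \<in> e\<close> by blast
  then show "\<exists>c. c \<noteq> 0 \<and> Z' s e = c \<cdot>\<^sub>m Z s e"
  proof cases
    case 1
    then show ?thesis
      using gauge_transformation_unique[OF assms(1,3,4) _ _ inj(1) edges(2) _ \<open>s \<in> e\<close>] Z by blast
  next
    case 2
    then show ?thesis
      using gauge_transformation_unique[OF assms(1,3,4) _ _ inj(2) edges(3) _ \<open>s \<in> e\<close>] Z by blast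
  qed
qed

end
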